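(* For any policy $\pi_\theta$, the baseline functions which minimize the second moment $\mathbb{E}\big[\|\hat g\|^2\big]$ of the gradient estimator $$\hat g=\sum_{i=1}^n\big(F_i-\beta_\phi(\xi_i)\big)\frac{\partial \log \pi_\theta(a_i\mid s_i)}{\partial\theta}$$ are given by $$\beta_\phi(\xi_i)=\frac{\mathbb{E}\left[\left\langle \hat g_{\rm sf},\ \frac{\partial \log \pi_\theta(a_i\mid s_i)}{\partial\theta}\right\rangle\ \Big|\ \xi_i\right]}{\mathbb{E}\left[\left\langle \frac{\partial \log \pi_\theta(a_i\mid s_i)}{\partial\theta},\ \frac{\partial \log \pi_\theta(a_i\mid s_i)}{\partial\theta}\right\rangle\ \Big|\ \xi_i\right]},\qquad \hat g_{\rm sf}=\sum_{i=1}^n F_i\,\frac{\partial \log \pi_\theta(a_i\mid s_i)}{\partial\theta},$$ where $\langle\cdot,\cdot\rangle$ is the inner product, the expectations are with respect to the trajectory $(s_1,a_1,r_1),\ldots,(s_T,a_T,r_T)$, and $\xi_i$ may be any subset of $\{s_1,a_1,r_1,\ldots,s_i\}$.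
   Context: Setting: a reinforcement learning problem with discrete timesteps $t=1,\ldots,T$, each with a state $s_t\in\mathcal S$, an action $a_t\in\mathcal A$ and a reward $r_t$. Given $s_t$, the action $a_t$ is sampled from the policy $\pi_\theta(\cdot\mid s_t)$ (a probability if $\mathcal A$ is discrete, a probability density if $\mathcal A$ is continuous), with parameter vector $\theta$; given $(s_t,a_t)$, the environment gives the reward $r_t$ and generates the next state $s_{t+1}$, independently of $\theta$. The vector $\frac{\partial \log \pi_\theta(a_i\mid s_i)}{\partial\theta}$ is the $i$-th score function. Gradient estimator: $\hat g_{\rm sf}$ is the estimator without the baseline $\beta_\phi$. Each scalar $F_i$ is either an estimate of the return (for instance $\sum_{t=i}^T r_t$) or an advantage (an estimate of the return minus a value function baseline). The indices $i=1,\ldots,n$ index the transitions used in the gradient, which may be a random mini-batch of transitions from different episodes. Baseline: $\beta_\phi$ is a scalar-valued function with parameters $\phi$, accepting inputs $\xi_i$. A baseline is called optimal if, for the given $\theta$, the parameters $\phi$ minimize the variance $\mathbb{E}[\|\hat g\|^2]-\|\mathbb{E}[\hat g]\|^2$ of $\hat g$; since the baseline terms $\beta_\phi(\xi_i)\frac{\partial \log \pi_\theta(a_i\mid s_i)}{\partial\theta}$ have expectation zero, this is equivalent to minimizing the second moment $\mathbb{E}[\|\hat g\|^2]$. Here $\|\cdot\|$ is the Euclidean norm. Regularity: derivative in $\theta$ and integral (or sum) over actions of $\pi_\theta$ may be interchanged, so that $\int_{\mathcal A}\frac{\partial \pi_\theta(a\mid s)}{\partial\theta}\,da=0$ for every state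 $s$ (with a sum if $\mathcal A$ is discrete). *)

theory Defs
  imports "HOL-Probability.Probability"
begin

(* A policy is a family p th s a of densities of the action a with respect to the sigma-finite
   reference measure A.  For a countable discrete action set, A is a counting measure and
   p th s a is a probability; for continuous actions A is Lebesgue measure. *)

definition policy_family ::
    "'s measure \<Rightarrow> 'a measure \<Rightarrow> ('p \<Rightarrow> 's \<Rightarrow> 'a \<Rightarrow> real) \<Rightarrow> bool" where
  "policy_family S A p \<longleftrightarrow>
     (\<forall>th. (\<lambda>(s, a). p th s a) \<in> borel_measurable (S \<Otimes>\<^sub>M A)) \<and>
     (\<forall>th. \<forall>s\<in>space S. \<forall>a\<in>space A. 0 \<le> p th s a) \<and>
     (\<forall>th. \<forall>s\<in>space S. (\<integral>\<^sup>+ a. ennreal (p th s a) \<partial>A) = 1)"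

definition gradient :: "('p::euclidean_space \<Rightarrow> real) \<Rightarrow> 'p \<Rightarrow> 'p" where
  "gradient f th = (THE D. GDERIV f th :> D)"

(* Where p th s a = 0 the value is unspecified; this has probability zero under the policy. *)

definition score :: "('p::euclidean_space \<Rightarrow> 's \<Rightarrow> 'a \<Rightarrow> real) \<Rightarrow> 'p \<Rightarrow> 's \<Rightarrow> 'a \<Rightarrow> 'p" where
  "score p th s a = gradient (\<lambda>th'. ln (p th' s a)) th"

(* The last conjunct is the interchange of derivative and integral. Since the policy integrates
   to one, it entails that the integral of the gradient vanishes. *)

definition regular_policy ::
    "'s measure \<Rightarrow> 'a measure \<Rightarrow> ('p::euclidean_space \<Rightarrow> 's \<Rightarrow> 'a \<Rightarrow> real) \<Rightarrow> 'p \<Rightarrow> bool" where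
  "regular_policy S A p th \<longleftrightarrow>
     (\<lambda>(s, a). score p th s a) \<in> borel_measurable (S \<Otimes>\<^sub>M A) \<and>
     (\<forall>s\<in>space S. \<forall>a\<in>space A. (\<lambda>th'. p th' s a) differentiable (at th)) \<and>
     (\<forall>s\<in>space S. integrable A (\<lambda>a. gradient (\<lambda>th'. p th' s a) th) \<and>
        GDERIV (\<lambda>th'. \<integral>a. p th' s a \<partial>A) th :> (\<integral>a. gradient (\<lambda>th'. p th' s a) th \<partial>A))"

(* history s a r t is (s_1, ..., s_t), (a_1, ..., a_(t-1)), (r_1, ..., r_(t-1)). *)

definition history_space ::
    "'s measure \<Rightarrow> 'a measure \<Rightarrow> nat \<Rightarrow> ((nat \<Rightarrow> 's) \<times> (nat \<Rightarrow> 'a) \<times> (nat \<Rightarrow> real)) measure" where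
  "history_space S A t =
     (\<Pi>\<^sub>M k\<in>{1..t}. S) \<Otimes>\<^sub>M ((\<Pi>\<^sub>M k\<in>{1..<t}. A) \<Otimes>\<^sub>M (\<Pi>\<^sub>M k\<in>{1..<t}. borel))"

definition history ::
    "(nat \<Rightarrow> 'w \<Rightarrow> 's) \<Rightarrow> (nat \<Rightarrow> 'w \<Rightarrow> 'a) \<Rightarrow> (nat \<Rightarrow> 'w \<Rightarrow> real) \<Rightarrow> nat \<Rightarrow> 'w \<Rightarrow>
      (nat \<Rightarrow> 's) \<times> (nat \<Rightarrow> 'a) \<times> (nat \<Rightarrow> real)" where
  "history s a r t w =
     ((\<lambda>k\<in>{1..t}. s k w), (\<lambda>k\<in>{1..<t}. a k w), (\<lambda>k\<in>{1..<t}. r k w))"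

(* Keeping only the variables with labels in Js, Ja, Jr is an admissible measurable input map. *)

lemma sub_history_measurable:
  assumes "Js \<subseteq> {1..t}" "Ja \<subseteq> {1..<t}" "Jr \<subseteq> {1..<t}"
  shows "(\<lambda>(u, v, z). (restrict u Js, restrict v Ja, restrict z Jr)) \<in>
    history_space S A t \<rightarrow>\<^sub>M
      (\<Pi>\<^sub>M k\<in>Js. S) \<Otimes>\<^sub>M ((\<Pi>\<^sub>M k\<in>Ja. A) \<Otimes>\<^sub>M (\<Pi>\<^sub>M k\<in>Jr. borel))"
proof -
  have [measurable]:
    "(\<lambda>u. restrict u Js) \<in> (\<Pi>\<^sub>M k\<in>{1..t}. S) \<rightarrow>\<^sub>M (\<Pi>\<^sub>M k\<in>Js. S)"
    "(\<lambda>u. restrict u Ja) \<in> (\<Pi>\<^sub>M k\<in>{1..<t}. A) \<rightarrow>\<^sub>M (\<Pi>\<^sub>M k\<in>Ja. A)"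
    "(\<lambda>u. restrict u Jr) \<in> (\<Pi>\<^sub>M k\<in>{1..<t}. borel) \<rightarrow>\<^sub>M (\<Pi>\<^sub>M k\<in>Jr. (borel :: real measure))"
    using assms by (auto intro: measurable_restrict_subset)
  show ?thesis
    unfolding history_space_def by measurable
qed

(* For every t: the conditional law of a_t given the history up to s_t has density p (s_t) with
   respect to A, and the conditional law of (r_t, s_(t+1)) given the history and a_t is
   K (s_t, a_t). Both are stated as disintegrations of joint laws. *)

definition trajectory ::
    "'w measure \<Rightarrow> 's measure \<Rightarrow> 'a measure \<Rightarrow> ('s \<Rightarrow> 'a \<Rightarrow> real) \<Rightarrow> ('s \<times> 'a \<Rightarrow> (real \<times> 's) measure) \<Rightarrow>
      nat \<Rightarrow> (nat \<Rightarrow> 'w \<Rightarrow> 's) \<Rightarrow> (nat \<Rightarrow> 'w \<Rightarrow> 'a) \<Rightarrow> (nat \<Rightarrow> 'w \<Rightarrow> real) \<Rightarrow> bool" where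
  "trajectory M S A p K T s a r \<longleftrightarrow>
     (\<forall>t\<in>{1..Suc T}. s t \<in> M \<rightarrow>\<^sub>M S) \<and>
     (\<forall>t\<in>{1..T}. a t \<in> M \<rightarrow>\<^sub>M A \<and> r t \<in> borel_measurable M) \<and>
     (\<forall>t\<in>{1..T}.
        distr M (history_space S A t \<Otimes>\<^sub>M A) (\<lambda>w. (history s a r t w, a t w)) =
        density (distr M (history_space S A t) (history s a r t) \<Otimes>\<^sub>M A)
          (\<lambda>(h, x). ennreal (p (fst h t) x))) \<and>
     (\<forall>t\<in>{1..T}.
        distr M ((history_space S A t \<Otimes>\<^sub>M A) \<Otimes>\<^sub>M (borel \<Otimes>\<^sub>M S))
          (\<lambda>w. ((history s a r t w, a t w), (r t w, s (Suc t) w))) =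
        distr M (history_space S A t \<Otimes>\<^sub>M A) (\<lambda>w. (history s a r t w, a t w)) \<bind>
          (\<lambda>(h, x). distr (K (fst h t, x)) ((history_space S A t \<Otimes>\<^sub>M A) \<Otimes>\<^sub>M (borel \<Otimes>\<^sub>M S))
             (\<lambda>y. ((h, x), y))))"

definition trajectory_space ::
    "'s measure \<Rightarrow> 'a measure \<Rightarrow> nat \<Rightarrow> ((nat \<Rightarrow> 's) \<times> (nat \<Rightarrow> 'a) \<times> (nat \<Rightarrow> real)) measure" where
  "trajectory_space S A T =
     (\<Pi>\<^sub>M k\<in>{1..T}. S) \<Otimes>\<^sub>M ((\<Pi>\<^sub>M k\<in>{1..T}. A) \<Otimes>\<^sub>M (\<Pi>\<^sub>M k\<in>{1..T}. borel))"

definition whole_trajectory ::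
    "nat \<Rightarrow> (nat \<Rightarrow> 'w \<Rightarrow> 's) \<Rightarrow> (nat \<Rightarrow> 'w \<Rightarrow> 'a) \<Rightarrow> (nat \<Rightarrow> 'w \<Rightarrow> real) \<Rightarrow> 'w \<Rightarrow>
      (nat \<Rightarrow> 's) \<times> (nat \<Rightarrow> 'a) \<times> (nat \<Rightarrow> real)" where
  "whole_trajectory T s a r w =
     ((\<lambda>k\<in>{1..T}. s k w), (\<lambda>k\<in>{1..T}. a k w), (\<lambda>k\<in>{1..T}. r k w))"

definition independent_episodes where
  "independent_episodes M S A p K T E s a r \<longleftrightarrow>
     (\<forall>e\<in>{..<E}. trajectory M S A p K T (s e) (a e) (r e)) \<and>
     prob_space.indep_vars M (\<lambda>e. trajectory_space S A T)
       (\<lambda>e. whole_trajectory T (s e) (a e) (r e)) {..<E::nat}"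

(* sel i w = (e, t) means that the i-th transition used in the gradient is the one of episode e
   at timestep t. The transitions are drawn without repetition and independently of the episodes.
   A single episode with transitions 1, ..., n is the case E = 1, sel i w = (0, i). *)

definition transition_selection where
  "transition_selection M S A T E s a r n sel \<longleftrightarrow>
     (\<forall>i\<in>{1..n::nat}. sel i \<in> M \<rightarrow>\<^sub>M count_space ({..<E::nat} \<times> {1..T::nat})) \<and>
     (\<forall>i\<in>{1..n}. \<forall>j\<in>{1..n}. i \<noteq> j \<longrightarrow> (AE w in M. sel i w \<noteq> sel j w)) \<and>
     prob_space.indep_set M
       (sets (vimage_algebra (space M) (\<lambda>w. \<lambda>i\<in>{1..n}. sel i w)
         (\<Pi>\<^sub>M i\<in>{1..n}. count_space ({..<E} \<times> {1..T}))))
       (sets (vimage_algebra (space M) (\<lambda>w. \<lambda>e\<in>{..<E}. whole_trajectory T (s e) (a e) (r e) w)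
         (\<Pi>\<^sub>M e\<in>{..<E}. trajectory_space S A T)))"

(* The score functions and baseline inputs of the selected transitions. The map x i t extracts
   the input from the history up to s_t, for instance as in sub_history_measurable. *)

definition selected_score where
  "selected_score p th s a sel i w =
     (case sel i w of (e, t) \<Rightarrow> score p th (s e t w) (a e t w))"

definition selected_input where
  "selected_input x s a r sel i w =
     (case sel i w of (e, t) \<Rightarrow> x i t (history (s e) (a e) (r e) t w))"

definition g_sf ::
    "nat \<Rightarrow> (nat \<Rightarrow> 'w \<Rightarrow> real) \<Rightarrow> (nat \<Rightarrow> 'w \<Rightarrow> 'p::real_vector) \<Rightarrow> 'w \<Rightarrow> 'p" where
  "g_sf n F G w = (\<Sum>i=1..n. F i w *\<^sub>R G i w)"

(* A baseline assigns a function of the i-th input to each i; a single function shared by all i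
   is a constant family. *)

definition g_hat ::
    "nat \<Rightarrow> (nat \<Rightarrow> 'w \<Rightarrow> real) \<Rightarrow> (nat \<Rightarrow> 'w \<Rightarrow> 'x) \<Rightarrow> (nat \<Rightarrow> 'w \<Rightarrow> 'p::real_vector) \<Rightarrow>
      (nat \<Rightarrow> 'x \<Rightarrow> real) \<Rightarrow> 'w \<Rightarrow> 'p" where
  "g_hat n F \<xi> G \<beta> w = (\<Sum>i=1..n. (F i w - \<beta> i (\<xi> i w)) *\<^sub>R G i w)"

(* Extended-valued, so that estimators with infinite second moment are never preferred. *)

definition second_moment :: "'w measure \<Rightarrow> ('w \<Rightarrow> 'p::real_normed_vector) \<Rightarrow> ennreal" where
  "second_moment M g = (\<integral>\<^sup>+ w. ennreal ((norm (g w))\<^sup>2) \<partial>M)"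

definition cond_exp_given ::
    "'w measure \<Rightarrow> 'x measure \<Rightarrow> ('w \<Rightarrow> 'x) \<Rightarrow> ('w \<Rightarrow> real) \<Rightarrow> 'w \<Rightarrow> real" where
  "cond_exp_given M X \<xi> f = real_cond_exp M (vimage_algebra (space M) \<xi> X) f"

(* The values of a baseline matter only up to null sets, and the quotient is meaningful only where
   its denominator is nonzero: where E[<G i, G i> | \<xi> i] = 0, the score G i vanishes almost surely
   and the value of the baseline is irrelevant. *)

definition given_by_quotient ::
    "'w measure \<Rightarrow> (nat \<Rightarrow> 'x measure) \<Rightarrow> nat \<Rightarrow> (nat \<Rightarrow> 'w \<Rightarrow> real) \<Rightarrow> (nat \<Rightarrow> 'w \<Rightarrow> 'x) \<Rightarrow>
      (nat \<Rightarrow> 'w \<Rightarrow> 'p::real_inner) \<Rightarrow> (nat \<Rightarrow> 'x \<Rightarrow> real) \<Rightarrow> bool" where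
  "given_by_quotient M X n F \<xi> G \<beta> \<longleftrightarrow>
     (\<forall>i\<in>{1..n}. AE w in M.
        cond_exp_given M (X i) (\<xi> i) (\<lambda>w. G i w \<bullet> G i w) w \<noteq> 0 \<longrightarrow>
        \<beta> i (\<xi> i w) =
          cond_exp_given M (X i) (\<xi> i) (\<lambda>w. g_sf n F G w \<bullet> G i w) w /
          cond_exp_given M (X i) (\<xi> i) (\<lambda>w. G i w \<bullet> G i w) w)"

definition baselines :: "(nat \<Rightarrow> 'x measure) \<Rightarrow> nat \<Rightarrow> (nat \<Rightarrow> 'x \<Rightarrow> real) set" where
  "baselines X n = {\<beta>. \<forall>i\<in>{1..n}. \<beta> i \<in> borel_measurable (X i)}"

end

(* The terms of a baseline are mutually orthogonal: the score of a transition has mean zero given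
   everything that precedes it in its episode and given the other episodes, and of any two
   transitions one precedes the other in lexicographic order. Conditioning on the independent
   selection of transitions transfers this to a mini-batch. For an arbitrary measurable baseline the
   terms U_i G_i need not be square integrable, so orthogonality is proved as an identity of
   extended-valued integrals, E|sum U_i G_i|^2 = sum E|U_i G_i|^2, as for the fact that a
   square-integrable discrete local martingale has square-integrable increments.

   Consequently E|g_hat|^2 splits into one quadratic problem for each i, with conditional
   coefficients A_i = E[<g_sf, G_i> | xi_i] and B_i = E[|G_i|^2 | xi_i], and for V_i = A_i / B_i the
   Pythagorean identity
     E|g_sf - sum U_i G_i|^2 = E|g_sf - sum V_i G_i|^2 + sum E|(U_i - V_i) G_i|^2
   holds. The last sum vanishes iff U_i = V_i almost surely where B_i is nonzero. *)

theory Submission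
  imports Defs
begin

text \<open>An estimate F_i may depend on the whole future, so cross terms F_j <G_j, G_i> with j
  different from i need not vanish in expectation. Orthogonality is therefore claimed for the
  baseline terms only, and g_sf enters as one square-integrable vector that is projected onto the
  weighted scores; this is why the numerator of the quotient contains all of g_sf and not just F_i
  |G_i|^2. The positions of a mini-batch are in no temporal order, so what precedes the i-th
  transition depends on the random selection. Even for a fixed selection the pasts do not form a
  filtration, because the past of a transition contains the other episodes in full. The induction
  over summands only asks that each earlier term, as a whole, be measurable with respect to the past
  of the term being added. Conditional expectations are functions on the sample space, whereas
  baselines are functions of the inputs. The Doob-Dynkin factorization bridges this twice: it
  extends orthogonality from baselines to the quotients, and it yields a baseline that attains the
  minimum.\<close>

subsection \<open>Square-integrable orthogonal families\<close>

text \<open>Doob-Dynkin: each sublevel set of \<open>f\<close> at a rational level is the preimage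
  of some measurable \<open>B q\<close>, and \<open>f\<close> is recovered as the infimum of the
  levels \<open>q\<close> whose set contains the point.\<close>

lemma borel_measurable_vimage_algebra_factor:
  fixes f :: "'w \<Rightarrow> real"
  assumes \<xi>: "\<xi> \<in> \<Omega> \<rightarrow> space X" and f: "f \<in> borel_measurable (vimage_algebra \<Omega> \<xi> X)"
  obtains h where "h \<in> borel_measurable X" "\<And>w. w \<in> \<Omega> \<Longrightarrow> f w = h (\<xi> w)"
proof -
  have "\<forall>q::rat. \<exists>B. B \<in> sets X \<and> {w \<in> \<Omega>. f w \<le> of_rat q} = \<xi> -` B \<inter> \<Omega>"
  proof
    fix q :: rat
    have "{w \<in> space (vimage_algebra \<Omega> \<xi> X). f w \<le> of_rat q} \<in> sets (vimage_algebra \<Omega> \<xi> X)"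
      using f by measurable
    then show "\<exists>B. B \<in> sets X \<and> {w \<in> \<Omega>. f w \<le> of_rat q} = \<xi> -` B \<inter> \<Omega>"
      using sets_vimage_algebra2[OF \<xi>] by auto
  qed
  then obtain B where B: "\<And>q::rat. B q \<in> sets X"
    "\<And>q. {w \<in> \<Omega>. f w \<le> of_rat q} = \<xi> -` B q \<inter> \<Omega>"
    by metis
  \<comment> \<open>Outside the range of \<open>\<xi>\<close> the chosen sets \<open>B q\<close>
    need not be nested, and the infimum may be infinite there; hence the detour through extended
    reals.\<close>
  define h where "h y = (INF q::rat. if y \<in> B q then ereal (of_rat q) else \<infinity>)" for y
  note [measurable] = B(1)
  have [measurable]: "h \<in> borel_measurable X"
    unfolding h_def by measurable
  have h: "h (\<xi> w) = ereal (f w)" if "w \<in> \<Omega>" for w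
  proof (rule antisym)
    have iff: "\<xi> w \<in> B q \<longleftrightarrow> f w \<le> of_rat q" for q
      using B(2)[of q] that by auto
    show "ereal (f w) \<le> h (\<xi> w)"
      unfolding h_def by (rule INF_greatest) (simp add: iff)
    show "h (\<xi> w) \<le> ereal (f w)"
    proof (rule ereal_le_epsilon2)
      fix e :: real assume "0 < e"
      then obtain q where q: "f w < of_rat q" "of_rat q < f w + e"
        using of_rat_dense[of "f w" "f w + e"] by auto
      have "h (\<xi> w) \<le> ereal (of_rat q)"
        unfolding h_def by (rule INF_lower2[of q]) (use q in \<open>simp_all add: iff\<close>)
      also have "\<dots> \<le> ereal (f w) + ereal e"
        using q by simp
      finally show "h (\<xi> w) \<le> ereal (f w) + ereal e" .
    qed
  qed
  show ?thesis
    by (rule that[of "\<lambda>y. real_of_ereal (h y)"]) (simp_all add: h)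
qed

section \<open>Square-integrable vector-valued functions on a measure space\<close>

lemma integrable_inner_square:
  fixes f g :: "'w \<Rightarrow> 'p::euclidean_space"
  assumes [measurable]: "f \<in> borel_measurable M" "g \<in> borel_measurable M"
    and "integrable M (\<lambda>w. (norm (f w))\<^sup>2)" "integrable M (\<lambda>w. (norm (g w))\<^sup>2)"
  shows "integrable M (\<lambda>w. f w \<bullet> g w)"
proof (rule Bochner_Integration.integrable_bound)
  show "integrable M (\<lambda>w. (norm (f w))\<^sup>2 + (norm (g w))\<^sup>2)"
    using assms by simp
  show "AE w in M. norm (f w \<bullet> g w) \<le> norm ((norm (f w))\<^sup>2 + (norm (g w))\<^sup>2)"
  proof (rule AE_I2)
    fix w
    have "\<bar>f w \<bullet> g w\<bar> \<le> norm (f w) * norm (g w)"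
      by (rule Cauchy_Schwarz_ineq2)
    also have "\<dots> \<le> (norm (f w))\<^sup>2 + (norm (g w))\<^sup>2"
      using sum_squares_bound[of "norm (f w)" "norm (g w)"]
        mult_nonneg_nonneg[OF norm_ge_zero norm_ge_zero, of "f w" "g w"]
      unfolding mult.assoc by linarith
    finally show "norm (f w \<bullet> g w) \<le> norm ((norm (f w))\<^sup>2 + (norm (g w))\<^sup>2)"
      by simp
  qed
qed simp

lemma integrable_norm_square_iff:
  fixes f :: "'w \<Rightarrow> 'p::euclidean_space"
  assumes [measurable]: "f \<in> borel_measurable M"
  shows "integrable M (\<lambda>w. (norm (f w))\<^sup>2) \<longleftrightarrow> (\<integral>\<^sup>+ w. ennreal ((norm (f w))\<^sup>2) \<partial>M) < \<infinity>"
  by (simp add: integrable_iff_bounded)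

lemma norm_square_add_inner:
  fixes x y :: "'p::real_inner"
  shows "(norm (x + y))\<^sup>2 = (norm x)\<^sup>2 + (norm y)\<^sup>2 + 2 * (x \<bullet> y)"
  by (simp add: power2_norm_eq_inner inner_add_left inner_add_right inner_commute)

lemma inner_le_half_norm_squares:
  fixes x y :: "'p::real_inner"
  shows "x \<bullet> y \<le> ((norm x)\<^sup>2 + (norm y)\<^sup>2) / 2"
  using zero_le_power2[of "norm (x + - y)"]
  unfolding norm_square_add_inner inner_minus_right norm_minus_cancel by simp

lemma integral_norm_square_add:
  fixes f g :: "'w \<Rightarrow> 'p::euclidean_space"
  assumes [measurable]: "f \<in> borel_measurable M" "g \<in> borel_measurable M"
    and f: "integrable M (\<lambda>w. (norm (f w))\<^sup>2)" and g: "integrable M (\<lambda>w. (norm (g w))\<^sup>2)"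
  shows "integrable M (\<lambda>w. (norm (f w + g w))\<^sup>2)"
    and "(\<integral>w. (norm (f w + g w))\<^sup>2 \<partial>M) =
      (\<integral>w. (norm (f w))\<^sup>2 \<partial>M) + (\<integral>w. (norm (g w))\<^sup>2 \<partial>M) + 2 * (\<integral>w. f w \<bullet> g w \<partial>M)"
  using f g integrable_inner_square[OF assms]
  by (simp_all add: norm_square_add_inner)

lemma (in finite_measure) square_integrable_norm_imp_integrable:
  fixes f :: "'a \<Rightarrow> 'p::euclidean_space"
  assumes [measurable]: "f \<in> borel_measurable M" and f2: "integrable M (\<lambda>w. (norm (f w))\<^sup>2)"
  shows "integrable M f"
proof (rule Bochner_Integration.integrable_bound)
  show "integrable M (\<lambda>w. 1 + (norm (f w))\<^sup>2)" using f2 by simp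
  have "x \<le> 1 + x\<^sup>2" for x :: real
    using sum_squares_bound[of x 1] zero_le_power2[of x] unfolding mult_1_right one_power2 by linarith
  then show "AE w in M. norm (f w) \<le> norm (1 + (norm (f w))\<^sup>2)"
    by (intro AE_I2) (simp add: abs_of_nonneg add_nonneg_nonneg)
qed simp

text \<open>The hypothesis \<open>zero\<close> expresses that the conditional expectation of the
  vector \<open>H\<close> given \<open>N\<close> vanishes, by integrals over the sets of
  \<open>N\<close>. In each coordinate this is a statement about \<open>real_cond_exp\<close>, and
  the bounded \<open>N\<close>-measurable coordinate of \<open>V\<close> can be pulled out.\<close>

lemma (in finite_measure) integral_bounded_inner_eq_0:
  fixes H V :: "'a \<Rightarrow> 'p::euclidean_space"
  assumes sub: "subalgebra M N" and H: "integrable M H"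
    and zero: "\<And>B. B \<in> sets N \<Longrightarrow> (\<integral>w. indicator B w *\<^sub>R H w \<partial>M) = 0"
    and V: "V \<in> borel_measurable N" and bound: "\<And>w. norm (V w) \<le> c"
  shows "integrable M (\<lambda>w. V w \<bullet> H w)" "(\<integral>w. V w \<bullet> H w \<partial>M) = 0"
proof -
  interpret N: finite_measure_subalgebra M N
    using sub by unfold_locales
  have [measurable]: "V \<in> borel_measurable M"
    by (rule measurable_from_subalg[OF sub V])
  have [measurable]: "H \<in> borel_measurable M"
    using H by auto
  have int: "integrable M (\<lambda>w. (V w \<bullet> i) * (H w \<bullet> i))"
    if "i \<in> Basis" for i :: 'p
  proof (rule Bochner_Integration.integrable_bound)
    show "integrable M (\<lambda>w. c *\<^sub>R H w)" using H by simp
    show "AE w in M. norm ((V w \<bullet> i) * (H w \<bullet> i)) \<le> norm (c *\<^sub>R H w)"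
    proof (rule AE_I2)
      fix w
      have "\<bar>V w \<bullet> i\<bar> \<le> c" "\<bar>H w \<bullet> i\<bar> \<le> norm (H w)"
        using Basis_le_norm[OF that, of "V w"] Basis_le_norm[OF that, of "H w"] bound[of w] by auto
      then have "\<bar>V w \<bullet> i\<bar> * \<bar>H w \<bullet> i\<bar> \<le> c * norm (H w)"
        by (intro mult_mono) auto
      moreover have "0 \<le> c" using order_trans[OF norm_ge_zero bound] .
      ultimately show "norm ((V w \<bullet> i) * (H w \<bullet> i)) \<le> norm (c *\<^sub>R H w)"
        by (simp add: abs_mult)
    qed
  qed simp
  have 0: "(\<integral>w. (V w \<bullet> i) * (H w \<bullet> i) \<partial>M) = 0"
    if "i \<in> Basis" for i :: 'p
  proof -
    have "AE w in M. real_cond_exp M N (\<lambda>w. H w \<bullet> i) w = 0"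
    proof (rule N.real_cond_exp_charact)
      fix B assume "B \<in> sets N"
      then have "B \<in> sets M" using sub by (auto simp: subalgebra_def)
      then have "integrable M (\<lambda>w. indicator B w *\<^sub>R H w)"
        using H by (rule integrable_mult_indicator)
      then show "(\<integral>w\<in>B. H w \<bullet> i \<partial>M) = (\<integral>w\<in>B. 0 \<partial>M)"
        using integral_inner_left[of i M "\<lambda>w. indicator B w *\<^sub>R H w"] zero[OF \<open>B \<in> sets N\<close>]
        by (simp add: set_lebesgue_integral_def)
    qed (use H in auto)
    then have "(\<integral>w. (V w \<bullet> i) * real_cond_exp M N (\<lambda>w. H w \<bullet> i) w \<partial>M) = (\<integral>w. 0 \<partial>M)"
      by (intro integral_cong_AE) auto
    then show ?thesis
      using N.real_cond_exp_intg(2)[OF int[OF that]] V by simp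
  qed
  show "integrable M (\<lambda>w. V w \<bullet> H w)"
    by (subst euclidean_inner) (auto intro: int)
  show "(\<integral>w. V w \<bullet> H w \<partial>M) = 0"
    by (subst euclidean_inner) (simp add: int 0)
qed

lemma nn_integral_incseq_indicator:
  fixes C :: "nat \<Rightarrow> 'a set"
  assumes f: "f \<in> borel_measurable M" and C: "\<And>m. C m \<in> sets M" "incseq C" "(\<Union>m. C m) = space M"
  shows "(\<integral>\<^sup>+ w. f w \<partial>M) = (SUP m. \<integral>\<^sup>+ w. f w * indicator (C m) w \<partial>M)"
proof -
  have "(\<integral>\<^sup>+ w. f w \<partial>M) = (\<integral>\<^sup>+ w. (SUP m. f w * indicator (C m) w) \<partial>M)"
  proof (rule nn_integral_cong)
    fix w assume "w \<in> space M"
    then obtain m where m: "w \<in> C m" using C(3) by auto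
    show "f w = (SUP m. f w * indicator (C m) w)"
    proof (rule antisym)
      show "f w \<le> (SUP m. f w * indicator (C m) w)"
        using m by (intro SUP_upper2[of m]) auto
      show "(SUP m. f w * indicator (C m) w) \<le> f w"
        by (rule SUP_least) (auto split: split_indicator)
    qed
  qed
  also have "\<dots> = (SUP m. \<integral>\<^sup>+ w. f w * indicator (C m) w \<partial>M)"
  proof (rule nn_integral_monotone_convergence_SUP)
    show "incseq (\<lambda>m w. f w * indicator (C m) w)"
      using \<open>incseq C\<close> by (auto simp: incseq_def le_fun_def split: split_indicator)
  qed (use f C in measurable)
  finally show ?thesis .
qed

(* W H need not be square integrable, so the mixed term is only integrated over the sets C m on which
   Z and W are bounded; these belong to N, and monotone convergence removes them. *)

lemma (in finite_measure) nn_integral_norm_square_orthogonal_increment: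
  fixes H Z :: "'a \<Rightarrow> 'p::euclidean_space" and W :: "'a \<Rightarrow> real"
  assumes sub: "subalgebra M N" and H [measurable]: "H \<in> borel_measurable M"
    and H2: "integrable M (\<lambda>w. (norm (H w))\<^sup>2)"
    and zero: "\<And>B. B \<in> sets N \<Longrightarrow> (\<integral>w. indicator B w *\<^sub>R H w \<partial>M) = 0"
    and Z: "Z \<in> borel_measurable N" and W: "W \<in> borel_measurable N"
  shows "(\<integral>\<^sup>+ w. ennreal ((norm (Z w + W w *\<^sub>R H w))\<^sup>2) \<partial>M) =
    (\<integral>\<^sup>+ w. ennreal ((norm (Z w))\<^sup>2) \<partial>M) + (\<integral>\<^sup>+ w. ennreal ((norm (W w *\<^sub>R H w))\<^sup>2) \<partial>M)"
proof -
  have HI: "integrable M H"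
    by (rule square_integrable_norm_imp_integrable[OF H H2])
  note [measurable] = measurable_from_subalg[OF sub Z] measurable_from_subalg[OF sub W]
  define C where "C m = {w \<in> space N. norm (Z w) \<le> real m \<and> \<bar>W w\<bar> \<le> real m}" for m
  have sp: "space N = space M" using sub by (simp add: subalgebra_def)
  have CN [measurable]: "C m \<in> sets N" for m
    unfolding C_def using Z W by measurable
  then have CM [measurable]: "C m \<in> sets M" for m
    using sub by (auto simp: subalgebra_def)
  have incC: "incseq C"
    by (auto simp: incseq_def C_def intro: order_trans)
  have UC: "(\<Union>m. C m) = space M"
  proof -
    have "\<exists>m. w \<in> C m" if "w \<in> space M" for w
    proof -
      obtain m :: nat where "max (norm (Z w)) \<bar>W w\<bar> \<le> real m"
        using real_arch_simple by blast
      then show ?thesis using that by (auto simp: C_def sp)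
    qed
    then show ?thesis by (auto simp: C_def sp)
  qed
  define I where "I f m = (\<integral>\<^sup>+ w. ennreal ((norm (f w))\<^sup>2) * indicator (C m) w \<partial>M)"
    for f :: "'a \<Rightarrow> 'p" and m
  have sup: "(\<integral>\<^sup>+ w. ennreal ((norm (f w))\<^sup>2) \<partial>M) = (SUP m. I f m)"
    if "f \<in> borel_measurable M" for f :: "'a \<Rightarrow> 'p"
    unfolding I_def by (rule nn_integral_incseq_indicator[OF _ CM incC UC]) (use that in measurable)
  have add: "I (\<lambda>w. Z w + W w *\<^sub>R H w) m = I Z m + I (\<lambda>w. W w *\<^sub>R H w) m" for m
  proof -
    define z where "z w = indicator (C m) w *\<^sub>R Z w" for w
    define y where "y w = (indicator (C m) w * W w) *\<^sub>R H w" for w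
    have [measurable]: "z \<in> borel_measurable M" "y \<in> borel_measurable M"
      unfolding z_def[abs_def] y_def[abs_def] by measurable
    have zb: "norm (z w) \<le> real m" "\<bar>indicator (C m) w * W w\<bar> \<le> real m" for w
      by (auto simp: z_def C_def split: split_indicator)
    have z2: "integrable M (\<lambda>w. (norm (z w))\<^sup>2)"
      by (rule integrable_const_bound[of _ "(real m)\<^sup>2"]) (auto intro!: power_mono zb)
    have y2: "integrable M (\<lambda>w. (norm (y w))\<^sup>2)"
    proof (rule Bochner_Integration.integrable_bound)
      show "integrable M (\<lambda>w. (real m)\<^sup>2 * (norm (H w))\<^sup>2)" using H2 by simp
      have "(indicator (C m) w * W w)\<^sup>2 \<le> (real m)\<^sup>2" for w
        using power_mono[OF zb(2)[of w] abs_ge_zero, of 2] by simp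
      then show "AE w in M. norm ((norm (y w))\<^sup>2) \<le> norm ((real m)\<^sup>2 * (norm (H w))\<^sup>2)"
        by (auto simp: y_def power_mult_distrib intro!: mult_right_mono)
    qed simp
    \<comment> \<open>Moving the scalar factor of \<open>y\<close> to the other side turns the mixed
      term into the inner product of \<open>H\<close> with an \<open>N\<close>-measurable vector
      bounded by \<open>real m * real m\<close>.\<close>
    have "(\<lambda>w. (indicator (C m) w * W w) *\<^sub>R z w) \<in> borel_measurable N"
      unfolding z_def using Z W by measurable
    moreover have "norm ((indicator (C m) w * W w) *\<^sub>R z w) \<le> real m * real m" for w
      using mult_mono[OF zb(2)[of w] zb(1)[of w]] by simp
    ultimately have "(\<integral>w. ((indicator (C m) w * W w) *\<^sub>R z w) \<bullet> H w \<partial>M) = 0"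
      by (intro integral_bounded_inner_eq_0(2)[OF sub HI]) (auto intro: zero)
    then have "(\<integral>w. z w \<bullet> y w \<partial>M) = 0"
      by (simp add: y_def)
    then have eq: "(\<integral>w. (norm (z w + y w))\<^sup>2 \<partial>M) = (\<integral>w. (norm (z w))\<^sup>2 \<partial>M) + (\<integral>w. (norm (y w))\<^sup>2 \<partial>M)"
      using integral_norm_square_add(2)[OF _ _ z2 y2] by simp
    have conv: "I f m = ennreal (\<integral>w. (norm (g w))\<^sup>2 \<partial>M)"
      if "integrable M (\<lambda>w. (norm (g w))\<^sup>2)" and "\<And>w. indicator (C m) w *\<^sub>R f w = g w" for f g :: "'a \<Rightarrow> 'p"
      unfolding I_def
      by (subst nn_integral_eq_integral[OF that(1), symmetric])
         (auto simp: that(2)[symmetric] split: split_indicator intro!: nn_integral_cong)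
    have "I Z m = ennreal (\<integral>w. (norm (z w))\<^sup>2 \<partial>M)"
      by (rule conv[OF z2]) (simp add: z_def)
    moreover have "I (\<lambda>w. W w *\<^sub>R H w) m = ennreal (\<integral>w. (norm (y w))\<^sup>2 \<partial>M)"
      by (rule conv[OF y2]) (simp add: y_def)
    moreover have "I (\<lambda>w. Z w + W w *\<^sub>R H w) m = ennreal (\<integral>w. (norm (z w + y w))\<^sup>2 \<partial>M)"
      by (rule conv[OF integral_norm_square_add(1)[OF _ _ z2 y2]])
         (simp_all add: z_def y_def scaleR_add_right)
    ultimately show ?thesis
      by (simp add: eq ennreal_plus)
  qed
  have inc: "incseq (I f)" for f
  proof (rule monoI)
    fix m m' :: nat assume "m \<le> m'"
    with incC have "C m \<subseteq> C m'" by (rule monoD)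
    then show "I f m \<le> I f m'"
      unfolding I_def by (auto split: split_indicator intro!: nn_integral_mono)
  qed
  have "(\<integral>\<^sup>+ w. ennreal ((norm (Z w + W w *\<^sub>R H w))\<^sup>2) \<partial>M) = (SUP m. I Z m + I (\<lambda>w. W w *\<^sub>R H w) m)"
    by (subst sup) (simp_all add: add)
  also have "\<dots> = (SUP m. I Z m) + (SUP m. I (\<lambda>w. W w *\<^sub>R H w) m)"
    by (rule ennreal_SUP_add[OF inc inc])
  also have "(SUP m. I Z m) = (\<integral>\<^sup>+ w. ennreal ((norm (Z w))\<^sup>2) \<partial>M)"
    by (rule sup[symmetric]) simp
  also have "(SUP m. I (\<lambda>w. W w *\<^sub>R H w) m) = (\<integral>\<^sup>+ w. ennreal ((norm (W w *\<^sub>R H w))\<^sup>2) \<partial>M)"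
    by (rule sup[symmetric]) simp
  finally show ?thesis .
qed

text \<open>When summands are added in order of \<open>rank\<close>, the partial sum is measurable
  with respect to \<open>N k\<close> of the new index, so the orthogonal increment applies. The
  \<open>N k\<close> are not assumed nested; only the products \<open>W j H j\<close> of lower rank
  have to be \<open>N k\<close>-measurable. Injectivity of \<open>rank\<close> excludes ties, for
  which \<open>past\<close> gives nothing.\<close>

lemma (in finite_measure) nn_integral_norm_square_sum_orthogonal:
  fixes H :: "'k \<Rightarrow> 'a \<Rightarrow> 'p::euclidean_space" and W :: "'k \<Rightarrow> 'a \<Rightarrow> real" and rank :: "'k \<Rightarrow> nat"
  assumes "finite I" and "inj_on rank I"
    and sub: "\<And>k. k \<in> I \<Longrightarrow> subalgebra M (N k)"
    and H: "\<And>k. k \<in> I \<Longrightarrow> H k \<in> borel_measurable M"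
      "\<And>k. k \<in> I \<Longrightarrow> integrable M (\<lambda>w. (norm (H k w))\<^sup>2)"
    and zero: "\<And>k B. k \<in> I \<Longrightarrow> B \<in> sets (N k) \<Longrightarrow> (\<integral>w. indicator B w *\<^sub>R H k w \<partial>M) = 0"
    and W: "\<And>k. k \<in> I \<Longrightarrow> W k \<in> borel_measurable (N k)"
    and past: "\<And>j k. j \<in> I \<Longrightarrow> k \<in> I \<Longrightarrow> rank j < rank k \<Longrightarrow>
      (\<lambda>w. W j w *\<^sub>R H j w) \<in> borel_measurable (N k)"
  shows "(\<integral>\<^sup>+ w. ennreal ((norm (\<Sum>k\<in>I. W k w *\<^sub>R H k w))\<^sup>2) \<partial>M) =
    (\<Sum>k\<in>I. \<integral>\<^sup>+ w. ennreal ((norm (W k w *\<^sub>R H k w))\<^sup>2) \<partial>M)"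
proof -
  have "J \<subseteq> I \<longrightarrow> (\<integral>\<^sup>+ w. ennreal ((norm (\<Sum>k\<in>J. W k w *\<^sub>R H k w))\<^sup>2) \<partial>M) =
    (\<Sum>k\<in>J. \<integral>\<^sup>+ w. ennreal ((norm (W k w *\<^sub>R H k w))\<^sup>2) \<partial>M)" if "finite J" for J
    using that
  proof (induction J rule: finite_ranking_induct[where f = rank])
    case (insert k J)
    show ?case
    \<comment> \<open>The ranking induction makes \<open>k\<close> maximal over \<open>J\<close> but
      does not exclude that it already belongs to \<open>J\<close>.\<close>
    proof (cases "k \<in> J")
      case False
      show ?thesis
      proof
        assume I: "insert k J \<subseteq> I"
        have "rank j < rank k" if "j \<in> J" for j
        proof -
          have "rank j \<noteq> rank k"
            using inj_onD[OF \<open>inj_on rank I\<close>, of j k] that I False by auto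
          then show ?thesis using insert.hyps(2)[OF that] by simp
        qed
        then have "(\<lambda>w. \<Sum>j\<in>J. W j w *\<^sub>R H j w) \<in> borel_measurable (N k)"
          using I by (intro borel_measurable_sum past) auto
        then have "(\<integral>\<^sup>+ w. ennreal ((norm ((\<Sum>j\<in>J. W j w *\<^sub>R H j w) + W k w *\<^sub>R H k w))\<^sup>2) \<partial>M) =
          (\<integral>\<^sup>+ w. ennreal ((norm (\<Sum>j\<in>J. W j w *\<^sub>R H j w))\<^sup>2) \<partial>M) +
          (\<integral>\<^sup>+ w. ennreal ((norm (W k w *\<^sub>R H k w))\<^sup>2) \<partial>M)"
          using I by (intro nn_integral_norm_square_orthogonal_increment[where N = "N k"] sub H zero W) auto
        moreover have "(\<integral>\<^sup>+ w. ennreal ((norm (\<Sum>j\<in>J. W j w *\<^sub>R H j w))\<^sup>2) \<partial>M) =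
          (\<Sum>j\<in>J. \<integral>\<^sup>+ w. ennreal ((norm (W j w *\<^sub>R H j w))\<^sup>2) \<partial>M)"
          using insert.IH I by blast
        ultimately show "(\<integral>\<^sup>+ w. ennreal ((norm (\<Sum>k\<in>insert k J. W k w *\<^sub>R H k w))\<^sup>2) \<partial>M) =
          (\<Sum>k\<in>insert k J. \<integral>\<^sup>+ w. ennreal ((norm (W k w *\<^sub>R H k w))\<^sup>2) \<partial>M)"
          using insert.hyps(1) False by (simp add: add.commute)
      qed
    qed (use insert in \<open>simp add: insert_absorb\<close>)
  qed simp
  with \<open>finite I\<close> show ?thesis by blast
qed

text \<open>By independence, the restriction of \<open>M\<close> to \<open>C\<close> and the
  multiple of \<open>M\<close> by the probability of \<open>C\<close> agree on all sets of
  \<open>N\<close>. They then integrate every \<open>N\<close>-measurable function alike, including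
  those with infinite integral.\<close>

lemma (in prob_space) nn_integral_indep_indicator:
  fixes f :: "'a \<Rightarrow> ennreal"
  assumes indep: "indep_set \<A> (sets N)" and sub: "subalgebra M N"
    and C: "C \<in> \<A>" and f: "f \<in> borel_measurable N"
  shows "(\<integral>\<^sup>+ w. f w * indicator C w \<partial>M) = emeasure M C * (\<integral>\<^sup>+ w. f w \<partial>M)"
proof -
  have CM [measurable]: "C \<in> sets M"
    using indep C by (auto simp: indep_set_def indep_sets_def split: bool.splits)
  have fM: "f \<in> borel_measurable M"
    by (rule measurable_from_subalg[OF sub f])
  have id: "(\<lambda>w. w) \<in> M \<rightarrow>\<^sub>M N"
    using sub by (auto simp: subalgebra_def measurable_def)
  have "distr (density M (indicator C)) N (\<lambda>w. w) = scale_measure (emeasure M C) (distr M N (\<lambda>w. w))"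
  proof (rule measure_eqI)
    fix B assume "B \<in> sets (distr (density M (indicator C)) N (\<lambda>w. w))"
    then have B: "B \<in> sets N" by simp
    then have BM [measurable]: "B \<in> sets M" using sub by (auto simp: subalgebra_def)
    have "emeasure M (C \<inter> B) = emeasure M C * emeasure M B"
      using indep_setD[OF indep C B] by (simp add: emeasure_eq_measure ennreal_mult)
    moreover have "B \<inter> space M = B" using sets.sets_into_space[OF BM] by auto
    ultimately show "emeasure (distr (density M (indicator C)) N (\<lambda>w. w)) B =
        emeasure (scale_measure (emeasure M C) (distr M N (\<lambda>w. w))) B"
      using B id by (simp add: emeasure_distr emeasure_density nn_integral_indicator
        flip: indicator_inter_arith)
  qed simp
  then have "(\<integral>\<^sup>+ w. f w \<partial>distr (density M (indicator C)) N (\<lambda>w. w)) =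
      (\<integral>\<^sup>+ w. f w \<partial>scale_measure (emeasure M C) (distr M N (\<lambda>w. w)))"
    by simp
  then show ?thesis
    using id f fM by (simp add: nn_integral_distr nn_integral_density nn_integral_scale_measure mult.commute)
qed

subsection \<open>Projection onto orthogonal weighted families\<close>

context finite_measure_subalgebra
begin

text \<open>The set where \<open>V\<close> is nonzero belongs to \<open>F\<close>, so |G|^2 and its
  conditional expectation have the same integral over it. Both are nonnegative almost everywhere, so
  one vanishes almost everywhere on that set iff the other does. This settles in which sense an
  optimal baseline is unique.\<close>

lemma nn_integral_norm_square_scaleR_eq_0_iff:
  fixes G :: "'a \<Rightarrow> 'p::euclidean_space"
  assumes [measurable]: "G \<in> borel_measurable M" and G2: "integrable M (\<lambda>w. G w \<bullet> G w)"
    and V: "V \<in> borel_measurable F"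
  shows "(\<integral>\<^sup>+ w. ennreal ((norm (V w *\<^sub>R G w))\<^sup>2) \<partial>M) = 0 \<longleftrightarrow>
    (AE w in M. real_cond_exp M F (\<lambda>w. G w \<bullet> G w) w \<noteq> 0 \<longrightarrow> V w = 0)"
proof -
  let ?B = "real_cond_exp M F (\<lambda>w. G w \<bullet> G w)"
  have [measurable]: "V \<in> borel_measurable M"
    by (rule measurable_from_subalg[OF subalg V])
  define C where "C = {w \<in> space F. V w \<noteq> 0}"
  have CF: "C \<in> sets F"
    unfolding C_def using V by measurable
  then have [measurable]: "C \<in> sets M"
    using subalg by (auto simp: subalgebra_def)
  have C_iff: "w \<in> C \<longleftrightarrow> V w \<noteq> 0" if "w \<in> space M" for w
    using that subalg by (auto simp: C_def subalgebra_def)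
  have intB: "integrable M ?B"
    using G2 by (rule real_cond_exp_int)
  have B_nonneg: "AE w in M. 0 \<le> ?B w"
    by (rule real_cond_exp_pos) auto
  have "(\<integral>\<^sup>+ w. ennreal ((norm (V w *\<^sub>R G w))\<^sup>2) \<partial>M) = 0 \<longleftrightarrow> (AE w in M. V w *\<^sub>R G w = 0)"
    by (subst nn_integral_0_iff_AE) auto
  also have "\<dots> \<longleftrightarrow> (AE w in M. indicator C w * (G w \<bullet> G w) = 0)"
    by (rule AE_cong) (auto simp: C_iff indicator_def)
  also have "\<dots> \<longleftrightarrow> (\<integral>w. indicator C w * (G w \<bullet> G w) \<partial>M) = 0"
    using integrable_mult_indicator[OF _ G2, of C]
    by (subst integral_nonneg_eq_0_iff_AE) auto
  also have "(\<integral>w. indicator C w * (G w \<bullet> G w) \<partial>M) = (\<integral>w. indicator C w * ?B w \<partial>M)"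
    using real_cond_exp_intA[OF G2 CF] by (simp add: set_lebesgue_integral_def)
  also have "\<dots> = 0 \<longleftrightarrow> (AE w in M. indicator C w * ?B w = 0)"
    using integrable_mult_indicator[OF _ intB, of C] B_nonneg
    by (subst integral_nonneg_eq_0_iff_AE) auto
  also have "\<dots> \<longleftrightarrow> (AE w in M. ?B w \<noteq> 0 \<longrightarrow> V w = 0)"
    by (rule AE_cong) (auto simp: C_iff indicator_def)
  finally show ?thesis .
qed

text \<open>\<open>u\<close> is the coefficient of the orthogonal projection of \<open>g\<close>
  onto the vectors V G with \<open>F\<close>-measurable \<open>V\<close>. Where the denominator
  vanishes, \<open>u\<close> is 0 by the convention for division.\<close>

context
  fixes G g :: "'a \<Rightarrow> 'p::euclidean_space" and u :: "'a \<Rightarrow> real"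
  assumes G [measurable]: "G \<in> borel_measurable M" and g [measurable]: "g \<in> borel_measurable M"
    and G2: "integrable M (\<lambda>w. (norm (G w))\<^sup>2)" and g2: "integrable M (\<lambda>w. (norm (g w))\<^sup>2)"
  defines "u \<equiv> \<lambda>w. real_cond_exp M F (\<lambda>w. g w \<bullet> G w) w / real_cond_exp M F (\<lambda>w. G w \<bullet> G w) w"
begin

lemma quotient_measurable: "u \<in> borel_measurable F" "u \<in> borel_measurable M"
proof -
  show "u \<in> borel_measurable F"
    unfolding u_def by measurable
  then show "u \<in> borel_measurable M"
    by (rule measurable_from_subalg[OF subalg])
qed

text \<open>Only the zero set of the denominator needs an argument: \<open>G\<close> vanishes almost
  surely there, hence so does the numerator.\<close>

lemma quotient_times_denominator:
  "AE w in M. u w * real_cond_exp M F (\<lambda>w. G w \<bullet> G w) w = real_cond_exp M F (\<lambda>w. g w \<bullet> G w) w"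
proof -
  let ?A = "real_cond_exp M F (\<lambda>w. g w \<bullet> G w)" and ?B = "real_cond_exp M F (\<lambda>w. G w \<bullet> G w)"
  \<comment> \<open>The indicator of the zero set serves as a test weight: V G = 0 almost
    everywhere, so the conditional expectation of V <g, G> is 0, and pulling \<open>V\<close> out
    shows that the numerator is 0 where \<open>V\<close> is 1.\<close>
  define V where "V w = (if ?B w = 0 then 1 else 0 :: real)" for w
  have V: "V \<in> borel_measurable F" unfolding V_def[abs_def] by measurable
  have [measurable]: "V \<in> borel_measurable M"
    by (rule measurable_from_subalg[OF subalg V])
  have gG: "integrable M (\<lambda>w. g w \<bullet> G w)"
    by (rule integrable_inner_square[OF g G g2 G2])
  have "(\<integral>\<^sup>+ w. ennreal ((norm (V w *\<^sub>R G w))\<^sup>2) \<partial>M) = 0"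
    by (subst nn_integral_norm_square_scaleR_eq_0_iff[OF G _ V])
      (use G2 in \<open>auto simp: V_def power2_norm_eq_inner\<close>)
  then have "AE w in M. V w *\<^sub>R G w = 0"
    by (subst (asm) nn_integral_0_iff_AE) auto
  then have ae0: "AE w in M. V w * (g w \<bullet> G w) = 0"
    by eventually_elim auto
  have "AE w in M. real_cond_exp M F (\<lambda>w. V w * (g w \<bullet> G w)) w = real_cond_exp M F (\<lambda>w. 0) w"
    by (rule real_cond_exp_cong[OF ae0]) auto
  moreover have "AE w in M. real_cond_exp M F (\<lambda>w. 0) w = 0"
    by (rule real_cond_exp_F_meas) auto
  moreover have "AE w in M. real_cond_exp M F (\<lambda>w. V w * (g w \<bullet> G w)) w = V w * ?A w"
  proof (rule real_cond_exp_mult[OF V])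
    have "integrable M (\<lambda>w. 0 :: real)" by simp
    then show "integrable M (\<lambda>w. V w * (g w \<bullet> G w))"
      by (rule integrable_cong_AE_imp) (use ae0 in \<open>auto elim: eventually_mono\<close>)
  qed simp
  ultimately show ?thesis
    by eventually_elim (auto simp: u_def V_def split: if_splits)
qed

text \<open>\<open>V\<close> is moved in and out of the conditional expectations, with the numerator
  replaced by \<open>u\<close> times the denominator in between. Integrability of u V |G|^2 is a
  hypothesis because u G is not yet known to be square integrable: the identity is used first for
  truncations of \<open>u\<close>, to prove exactly that, and then for general
  \<open>V\<close>.\<close>

lemma integral_inner_quotient_product:
  assumes V: "V \<in> borel_measurable F" and V2: "integrable M (\<lambda>w. (norm (V w *\<^sub>R G w))\<^sup>2)"
    and uV: "integrable M (\<lambda>w. (u w * V w) * (G w \<bullet> G w))"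
  shows "(\<integral>w. g w \<bullet> (V w *\<^sub>R G w) \<partial>M) = (\<integral>w. (u w * V w) * (G w \<bullet> G w) \<partial>M)"
proof -
  let ?A = "real_cond_exp M F (\<lambda>w. g w \<bullet> G w)" and ?B = "real_cond_exp M F (\<lambda>w. G w \<bullet> G w)"
  have [measurable]: "V \<in> borel_measurable M"
    by (rule measurable_from_subalg[OF subalg V])
  note [measurable] = quotient_measurable
  have "integrable M (\<lambda>w. g w \<bullet> (V w *\<^sub>R G w))"
    by (rule integrable_inner_square) (use g2 V2 in auto)
  then have gV: "integrable M (\<lambda>w. V w * (g w \<bullet> G w))"
    by simp
  have "(\<integral>w. g w \<bullet> (V w *\<^sub>R G w) \<partial>M) = (\<integral>w. V w * ?A w \<partial>M)"
    using real_cond_exp_intg(2)[OF gV V] by simp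
  also have "\<dots> = (\<integral>w. (u w * V w) * ?B w \<partial>M)"
    by (rule integral_cong_AE) (use quotient_times_denominator in \<open>auto elim!: eventually_mono simp: quotient_measurable\<close>)
  also have "\<dots> = (\<integral>w. (u w * V w) * (G w \<bullet> G w) \<partial>M)"
    by (rule real_cond_exp_intg(2)[OF uV]) (auto intro!: borel_measurable_times quotient_measurable V)
  finally show ?thesis .
qed

(* Truncating u to W, the identity E[W^2 |G|^2] = E[W <g, G>] <= (E|g|^2 + E[W^2 |G|^2]) / 2
   bounds E[W^2 |G|^2] by E|g|^2 uniformly in the truncation level. *)

lemma quotient_square_integrable: "integrable M (\<lambda>w. (norm (u w *\<^sub>R G w))\<^sup>2)"
proof -
  note [measurable] = quotient_measurable
  define C where "C m = {w \<in> space M. \<bar>u w\<bar> \<le> real m}" for m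
  have C [measurable]: "C m \<in> sets M" for m
    unfolding C_def by measurable
  have incC: "incseq C"
    by (auto simp: incseq_def C_def intro: order_trans)
  have UC: "(\<Union>m. C m) = space M"
    using real_arch_simple by (auto simp: C_def)
  have bound: "(\<integral>\<^sup>+ w. ennreal ((norm (u w *\<^sub>R G w))\<^sup>2) * indicator (C m) w \<partial>M)
      \<le> ennreal (\<integral>w. (norm (g w))\<^sup>2 \<partial>M)" for m
  proof -
    define W where "W w = (if \<bar>u w\<bar> \<le> real m then u w else 0)" for w
    have W: "W \<in> borel_measurable F" unfolding W_def[abs_def] by measurable
    have [measurable]: "W \<in> borel_measurable M"
      by (rule measurable_from_subalg[OF subalg W])
    have Wb: "\<bar>W w\<bar> \<le> real m" for w by (auto simp: W_def)
    have W2: "integrable M (\<lambda>w. (norm (W w *\<^sub>R G w))\<^sup>2)"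
    proof (rule Bochner_Integration.integrable_bound)
      show "integrable M (\<lambda>w. (real m)\<^sup>2 * (norm (G w))\<^sup>2)" using G2 by simp
      have "(W w)\<^sup>2 \<le> (real m)\<^sup>2" for w
        using power_mono[OF Wb[of w] abs_ge_zero, of 2] by simp
      then show "AE w in M. norm ((norm (W w *\<^sub>R G w))\<^sup>2) \<le> norm ((real m)\<^sup>2 * (norm (G w))\<^sup>2)"
        by (auto simp: power_mult_distrib intro!: mult_right_mono)
    qed simp
    \<comment> \<open>\<open>W\<close> equals \<open>u\<close> or 0, so u W = W^2; with V = W the
      product identity therefore has the second moment of W G on its right-hand side.\<close>
    have eq: "(u w * W w) * (G w \<bullet> G w) = (norm (W w *\<^sub>R G w))\<^sup>2" for w
      by (simp add: W_def power_mult_distrib dot_square_norm power2_eq_square[of "u w"])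
    have gW: "integrable M (\<lambda>w. g w \<bullet> (W w *\<^sub>R G w))"
      by (rule integrable_inner_square) (use g2 W2 in auto)
    have "(\<integral>w. (norm (W w *\<^sub>R G w))\<^sup>2 \<partial>M) = (\<integral>w. g w \<bullet> (W w *\<^sub>R G w) \<partial>M)"
      using integral_inner_quotient_product[OF W W2] W2 unfolding eq by simp
    also have "\<dots> \<le> (\<integral>w. ((norm (g w))\<^sup>2 + (norm (W w *\<^sub>R G w))\<^sup>2) / 2 \<partial>M)"
    proof (rule integral_mono[OF gW])
      fix w
      show "g w \<bullet> (W w *\<^sub>R G w) \<le> ((norm (g w))\<^sup>2 + (norm (W w *\<^sub>R G w))\<^sup>2) / 2"
        by (rule inner_le_half_norm_squares)
    qed (use g2 W2 in simp)
    also have "\<dots> = ((\<integral>w. (norm (g w))\<^sup>2 \<partial>M) + (\<integral>w. (norm (W w *\<^sub>R G w))\<^sup>2 \<partial>M)) / 2"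
      using g2 W2 by simp
    finally have le: "(\<integral>w. (norm (W w *\<^sub>R G w))\<^sup>2 \<partial>M) \<le> (\<integral>w. (norm (g w))\<^sup>2 \<partial>M)"
      by simp
    have "(\<integral>\<^sup>+ w. ennreal ((norm (u w *\<^sub>R G w))\<^sup>2) * indicator (C m) w \<partial>M) =
        (\<integral>\<^sup>+ w. ennreal ((norm (W w *\<^sub>R G w))\<^sup>2) \<partial>M)"
      by (rule nn_integral_cong) (auto simp: C_def W_def split: split_indicator)
    also have "\<dots> = ennreal (\<integral>w. (norm (W w *\<^sub>R G w))\<^sup>2 \<partial>M)"
      by (rule nn_integral_eq_integral[OF W2]) simp
    finally show ?thesis using le by (simp add: ennreal_leI)
  qed
  have "(\<integral>\<^sup>+ w. ennreal ((norm (u w *\<^sub>R G w))\<^sup>2) \<partial>M) =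
      (SUP m. \<integral>\<^sup>+ w. ennreal ((norm (u w *\<^sub>R G w))\<^sup>2) * indicator (C m) w \<partial>M)"
    by (rule nn_integral_incseq_indicator[OF _ C incC UC]) simp
  also have "\<dots> \<le> ennreal (\<integral>w. (norm (g w))\<^sup>2 \<partial>M)"
    by (rule SUP_least) (rule bound)
  also have "\<dots> < \<infinity>" by simp
  finally show ?thesis
    by (subst integrable_norm_square_iff) auto
qed

text \<open>The normal equation of the projection: the residual g - u G is orthogonal to every
  square-integrable V G.\<close>

lemma integral_inner_quotient:
  assumes V: "V \<in> borel_measurable F" and V2: "integrable M (\<lambda>w. (norm (V w *\<^sub>R G w))\<^sup>2)"
  shows "(\<integral>w. g w \<bullet> (V w *\<^sub>R G w) \<partial>M) = (\<integral>w. (u w *\<^sub>R G w) \<bullet> (V w *\<^sub>R G w) \<partial>M)"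
proof -
  note [measurable] = quotient_measurable(2) measurable_from_subalg[OF subalg V]
  have "integrable M (\<lambda>w. (u w *\<^sub>R G w) \<bullet> (V w *\<^sub>R G w))"
    by (rule integrable_inner_square) (use quotient_square_integrable V2 in auto)
  with integral_inner_quotient_product[OF V V2] show ?thesis
    by (simp add: mult_ac)
qed

end

end

text \<open>Separates the projection argument from the probability theory of trajectories. Since
  \<open>orthogonal\<close> covers all measurable weights and is extended-valued, it also controls
  integrability: a sum can have finite second moment only if each of its terms has.\<close>

locale orthogonal_weights = finite_measure M for M :: "'a measure" +
  fixes I :: "'i set" and N :: "'i \<Rightarrow> 'a measure" and G :: "'i \<Rightarrow> 'a \<Rightarrow> 'p::euclidean_space"
  assumes finite_I: "finite I"
    and subalgebras: "i \<in> I \<Longrightarrow> subalgebra M (N i)"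
    and G_measurable: "i \<in> I \<Longrightarrow> G i \<in> borel_measurable M"
    and G_square_integrable: "i \<in> I \<Longrightarrow> integrable M (\<lambda>w. (norm (G i w))\<^sup>2)"
    and orthogonal: "(\<And>i. i \<in> I \<Longrightarrow> v i \<in> borel_measurable (N i)) \<Longrightarrow>
      (\<integral>\<^sup>+ w. ennreal ((norm (\<Sum>i\<in>I. v i w *\<^sub>R G i w))\<^sup>2) \<partial>M) =
      (\<Sum>i\<in>I. \<integral>\<^sup>+ w. ennreal ((norm (v i w *\<^sub>R G i w))\<^sup>2) \<partial>M)"
begin

lemma weight_measurable:
  "i \<in> I \<Longrightarrow> v \<in> borel_measurable (N i) \<Longrightarrow> v \<in> borel_measurable M"
  using subalgebras measurable_from_subalg by blast

text \<open>Polarization: with weights \<open>v\<close> at \<open>i\<close>, \<open>v'\<close> at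
  \<open>j\<close> and 0 elsewhere, \<open>orthogonal\<close> leaves no room for the mixed term in
  the expansion of the squared norm of the sum.\<close>

lemma integral_inner_eq_0:
  assumes ij: "i \<in> I" "j \<in> I" "i \<noteq> j"
    and v: "v \<in> borel_measurable (N i)" "v' \<in> borel_measurable (N j)"
    and v2: "integrable M (\<lambda>w. (norm (v w *\<^sub>R G i w))\<^sup>2)" "integrable M (\<lambda>w. (norm (v' w *\<^sub>R G j w))\<^sup>2)"
  shows "(\<integral>w. (v w *\<^sub>R G i w) \<bullet> (v' w *\<^sub>R G j w) \<partial>M) = 0"
proof -
  note [measurable] = weight_measurable[OF ij(1) v(1)] weight_measurable[OF ij(2) v(2)]
    G_measurable[OF ij(1)] G_measurable[OF ij(2)]
  define V where "V k = (if k = i then v else if k = j then v' else (\<lambda>_. 0))" for k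
  have V: "V k \<in> borel_measurable (N k)" for k
    using v by (auto simp: V_def)
  have sum_ij: "(\<Sum>k\<in>I. f k) = f i + f j" if "\<And>k. k \<noteq> i \<Longrightarrow> k \<noteq> j \<Longrightarrow> f k = 0"
    for f :: "'i \<Rightarrow> 'c::comm_monoid_add"
  proof -
    have "(\<Sum>k\<in>I. f k) = (\<Sum>k\<in>{i, j}. f k)"
      by (rule sum.mono_neutral_right) (use finite_I ij that in auto)
    then show ?thesis using ij by simp
  qed
  have 1: "(\<Sum>k\<in>I. V k w *\<^sub>R G k w) = v w *\<^sub>R G i w + v' w *\<^sub>R G j w" for w
    using ij by (subst sum_ij) (auto simp: V_def)
  have 2: "(\<Sum>k\<in>I. \<integral>\<^sup>+ w. ennreal ((norm (V k w *\<^sub>R G k w))\<^sup>2) \<partial>M) =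
      (\<integral>\<^sup>+ w. ennreal ((norm (v w *\<^sub>R G i w))\<^sup>2) \<partial>M) + (\<integral>\<^sup>+ w. ennreal ((norm (v' w *\<^sub>R G j w))\<^sup>2) \<partial>M)"
    using ij by (subst sum_ij) (auto simp: V_def)
  note add = integral_norm_square_add[OF _ _ v2]
  have "ennreal (\<integral>w. (norm (v w *\<^sub>R G i w + v' w *\<^sub>R G j w))\<^sup>2 \<partial>M) =
      (\<integral>\<^sup>+ w. ennreal ((norm (v w *\<^sub>R G i w + v' w *\<^sub>R G j w))\<^sup>2) \<partial>M)"
    by (rule nn_integral_eq_integral[symmetric]) (use add in auto)
  also have "\<dots> = ennreal (\<integral>w. (norm (v w *\<^sub>R G i w))\<^sup>2 \<partial>M) + ennreal (\<integral>w. (norm (v' w *\<^sub>R G j w))\<^sup>2 \<partial>M)"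
    using orthogonal[of V, OF V] v2 unfolding 1 2 by (simp add: nn_integral_eq_integral)
  also have "\<dots> = ennreal ((\<integral>w. (norm (v w *\<^sub>R G i w))\<^sup>2 \<partial>M) + (\<integral>w. (norm (v' w *\<^sub>R G j w))\<^sup>2 \<partial>M))"
    by simp
  finally have "(\<integral>w. (norm (v w *\<^sub>R G i w + v' w *\<^sub>R G j w))\<^sup>2 \<partial>M) =
      (\<integral>w. (norm (v w *\<^sub>R G i w))\<^sup>2 \<partial>M) + (\<integral>w. (norm (v' w *\<^sub>R G j w))\<^sup>2 \<partial>M)"
    by (rule ennreal_inj[THEN iffD1, rotated 2]) (auto intro!: add_nonneg_nonneg)
  then show ?thesis
    using add(2) by simp
qed

text \<open>A finite sum in \<open>ennreal\<close> is finite iff all its summands are. The direction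
  from the sum to its terms excludes that terms of infinite second moment cancel.\<close>

lemma square_integrable_sum_iff:
  assumes v: "\<And>i. i \<in> I \<Longrightarrow> v i \<in> borel_measurable (N i)"
  shows "integrable M (\<lambda>w. (norm (\<Sum>i\<in>I. v i w *\<^sub>R G i w))\<^sup>2) \<longleftrightarrow>
    (\<forall>i\<in>I. integrable M (\<lambda>w. (norm (v i w *\<^sub>R G i w))\<^sup>2))"
proof -
  have vM: "(\<lambda>w. v i w *\<^sub>R G i w) \<in> borel_measurable M" if "i \<in> I" for i
    using weight_measurable[OF that v] G_measurable[OF that] that by measurable
  have "integrable M (\<lambda>w. (norm (\<Sum>i\<in>I. v i w *\<^sub>R G i w))\<^sup>2) \<longleftrightarrow>
      (\<Sum>i\<in>I. \<integral>\<^sup>+ w. ennreal ((norm (v i w *\<^sub>R G i w))\<^sup>2) \<partial>M) < \<infinity>"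
    using vM by (subst integrable_norm_square_iff) (simp_all add: orthogonal[OF v])
  also have "\<dots> \<longleftrightarrow> (\<forall>i\<in>I. (\<integral>\<^sup>+ w. ennreal ((norm (v i w *\<^sub>R G i w))\<^sup>2) \<partial>M) < \<infinity>)"
    using finite_I by simp
  also have "\<dots> \<longleftrightarrow> (\<forall>i\<in>I. integrable M (\<lambda>w. (norm (v i w *\<^sub>R G i w))\<^sup>2))"
    by (intro ball_cong refl) (simp only: vM integrable_norm_square_iff)
  finally show ?thesis .
qed

text \<open>With d_i = u_i - v_i, the estimator is the residual \<open>h\<close> of the projection
  plus D = sum d_i G_i. The residual is orthogonal to \<open>D\<close> by the normal equations, and
  \<open>orthogonal\<close> splits the second moment of \<open>D\<close>.\<close>

lemma second_moment_pythagoras: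
  fixes g :: "'a \<Rightarrow> 'p"
  assumes g [measurable]: "g \<in> borel_measurable M" and g2: "integrable M (\<lambda>w. (norm (g w))\<^sup>2)"
    and v: "\<And>i. i \<in> I \<Longrightarrow> v i \<in> borel_measurable (N i)"
    and u: "\<And>i. i \<in> I \<Longrightarrow> u i = (\<lambda>w. real_cond_exp M (N i) (\<lambda>w. g w \<bullet> G i w) w /
      real_cond_exp M (N i) (\<lambda>w. G i w \<bullet> G i w) w)"
  shows "second_moment M (\<lambda>w. g w - (\<Sum>i\<in>I. v i w *\<^sub>R G i w)) =
      second_moment M (\<lambda>w. g w - (\<Sum>i\<in>I. u i w *\<^sub>R G i w)) +
      (\<Sum>i\<in>I. second_moment M (\<lambda>w. (v i w - u i w) *\<^sub>R G i w))" (is "?thesis1")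
    and "second_moment M (\<lambda>w. g w - (\<Sum>i\<in>I. u i w *\<^sub>R G i w)) < \<infinity>" (is "?thesis2")
proof -
  have sub: "finite_measure_subalgebra M (N i)" if "i \<in> I" for i
    using subalgebras[OF that] by unfold_locales
  have uN: "u i \<in> borel_measurable (N i)"
    and u2: "integrable M (\<lambda>w. (norm (u i w *\<^sub>R G i w))\<^sup>2)"
    and u_inner: "\<And>V. V \<in> borel_measurable (N i) \<Longrightarrow> integrable M (\<lambda>w. (norm (V w *\<^sub>R G i w))\<^sup>2) \<Longrightarrow>
      (\<integral>w. g w \<bullet> (V w *\<^sub>R G i w) \<partial>M) = (\<integral>w. (u i w *\<^sub>R G i w) \<bullet> (V w *\<^sub>R G i w) \<partial>M)"
    if "i \<in> I" for i
    using finite_measure_subalgebra.quotient_measurable(1)[OF sub G_measurable g G_square_integrable g2, OF that that that]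
      finite_measure_subalgebra.quotient_square_integrable[OF sub G_measurable g G_square_integrable g2, OF that that that]
      finite_measure_subalgebra.integral_inner_quotient[OF sub G_measurable g G_square_integrable g2, OF that that that]
    unfolding u[OF that] by blast+
  define d where "d i w = u i w - v i w" for i w
  have dN: "d i \<in> borel_measurable (N i)" if "i \<in> I" for i
    unfolding d_def using uN[OF that] v[OF that] by measurable
  define h where "h w = g w - (\<Sum>i\<in>I. u i w *\<^sub>R G i w)" for w
  define D where "D w = (\<Sum>i\<in>I. d i w *\<^sub>R G i w)" for w
  have uG [measurable]: "(\<lambda>w. u i w *\<^sub>R G i w) \<in> borel_measurable M"
    and dG [measurable]: "(\<lambda>w. d i w *\<^sub>R G i w) \<in> borel_measurable M" if "i \<in> I" for i
    using weight_measurable[OF that uN] weight_measurable[OF that dN] G_measurable[OF that] that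
    by measurable
  have uS [measurable]: "(\<lambda>w. \<Sum>i\<in>I. u i w *\<^sub>R G i w) \<in> borel_measurable M"
    by (rule borel_measurable_sum) (rule uG)
  have hM [measurable]: "h \<in> borel_measurable M" unfolding h_def[abs_def] by measurable
  have DM [measurable]: "D \<in> borel_measurable M"
    unfolding D_def[abs_def] by (rule borel_measurable_sum) (rule dG)
  have "integrable M (\<lambda>w. (norm (\<Sum>i\<in>I. - u i w *\<^sub>R G i w))\<^sup>2)"
    by (subst square_integrable_sum_iff) (use uN u2 in auto)
  then have "integrable M (\<lambda>w. (norm (g w + (\<Sum>i\<in>I. - u i w *\<^sub>R G i w)))\<^sup>2)"
    by (intro integral_norm_square_add(1) g2) (use uS in \<open>auto simp: sum_negf\<close>)
  then have h2: "integrable M (\<lambda>w. (norm (h w))\<^sup>2)"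
    by (simp add: h_def sum_negf)
  then show ?thesis2
    using hM by (simp add: second_moment_def h_def integrable_norm_square_iff)
  have split: "g w - (\<Sum>i\<in>I. v i w *\<^sub>R G i w) = h w + D w" for w
    by (simp add: h_def D_def d_def scaleR_diff_left sum_subtractf)
  have sumD: "second_moment M D = (\<Sum>i\<in>I. second_moment M (\<lambda>w. (v i w - u i w) *\<^sub>R G i w))"
  proof -
    have "norm ((v i w - u i w) *\<^sub>R G i w) = norm (d i w *\<^sub>R G i w)" for i w
      by (simp add: d_def abs_minus_commute)
    then have "second_moment M (\<lambda>w. (v i w - u i w) *\<^sub>R G i w) = second_moment M (\<lambda>w. d i w *\<^sub>R G i w)" for i
      unfolding second_moment_def by (simp only:)
    moreover have "second_moment M D = (\<Sum>i\<in>I. second_moment M (\<lambda>w. d i w *\<^sub>R G i w))"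
      unfolding second_moment_def D_def by (rule orthogonal[OF dN])
    ultimately show ?thesis by simp
  qed
  have "second_moment M (\<lambda>w. h w + D w) = second_moment M h + second_moment M D"
  proof (cases "integrable M (\<lambda>w. (norm (D w))\<^sup>2)")
    \<comment> \<open>\<open>h\<close> is square integrable, so if h + D were square integrable,
      then so would be \<open>D\<close>; hence both sides are infinite.\<close>
    case False
    have top: "second_moment M D = \<infinity>"
      using False DM by (simp add: second_moment_def integrable_norm_square_iff less_top[symmetric])
    have "\<not> integrable M (\<lambda>w. (norm (h w + D w))\<^sup>2)"
    proof
      assume hD: "integrable M (\<lambda>w. (norm (h w + D w))\<^sup>2)"
      have "integrable M (\<lambda>w. (norm ((h w + D w) + - h w))\<^sup>2)"
        by (rule integral_norm_square_add(1)) (use hD h2 in auto)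
      then show False using False by simp
    qed
    then have "second_moment M (\<lambda>w. h w + D w) = \<infinity>"
      by (simp add: second_moment_def integrable_norm_square_iff less_top[symmetric])
    with top show ?thesis by simp
  next
    case True
    then have d2: "integrable M (\<lambda>w. (norm (d i w *\<^sub>R G i w))\<^sup>2)" if "i \<in> I" for i
      using square_integrable_sum_iff[OF dN] that unfolding D_def by blast
    have int_ud: "integrable M (\<lambda>w. (u j w *\<^sub>R G j w) \<bullet> (d i w *\<^sub>R G i w))" if "i \<in> I" "j \<in> I" for i j
      by (intro integrable_inner_square uG dG u2 d2 that)
    have int_gd: "integrable M (\<lambda>w. g w \<bullet> (d i w *\<^sub>R G i w))" if "i \<in> I" for i
      by (intro integrable_inner_square g dG g2 d2 that)
    \<comment> \<open>Of the terms u_j G_j subtracted in \<open>h\<close>, only j = i has a nonzero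
      product with d_i G_i, and it cancels the product with \<open>g\<close> by the normal
      equation.\<close>
    have "(\<integral>w. h w \<bullet> (d i w *\<^sub>R G i w) \<partial>M) = 0" if i: "i \<in> I" for i
    proof -
      have "(\<integral>w. h w \<bullet> (d i w *\<^sub>R G i w) \<partial>M) =
          (\<integral>w. g w \<bullet> (d i w *\<^sub>R G i w) - (\<Sum>j\<in>I. (u j w *\<^sub>R G j w) \<bullet> (d i w *\<^sub>R G i w)) \<partial>M)"
        by (simp only: h_def inner_diff_left inner_sum_left)
      also have "\<dots> = (\<integral>w. g w \<bullet> (d i w *\<^sub>R G i w) \<partial>M) -
          (\<Sum>j\<in>I. \<integral>w. (u j w *\<^sub>R G j w) \<bullet> (d i w *\<^sub>R G i w) \<partial>M)"
        using int_gd[OF i] int_ud[OF i]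
        by (subst Bochner_Integration.integral_diff)
           (auto simp del: inner_scaleR_left inner_scaleR_right intro!: Bochner_Integration.integral_sum)
      also have "(\<Sum>j\<in>I. \<integral>w. (u j w *\<^sub>R G j w) \<bullet> (d i w *\<^sub>R G i w) \<partial>M) =
          (\<Sum>j\<in>{i}. \<integral>w. (u j w *\<^sub>R G j w) \<bullet> (d i w *\<^sub>R G i w) \<partial>M)"
        by (rule sum.mono_neutral_right)
          (use finite_I i in \<open>auto simp del: inner_scaleR_left inner_scaleR_right
            intro!: integral_inner_eq_0 uN dN u2 d2\<close>)
      finally show ?thesis
        using u_inner[OF i dN[OF i] d2[OF i]] by simp
    qed
    moreover have "(\<integral>w. h w \<bullet> D w \<partial>M) = (\<Sum>i\<in>I. \<integral>w. h w \<bullet> (d i w *\<^sub>R G i w) \<partial>M)"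
      unfolding D_def inner_sum_right
      by (rule Bochner_Integration.integral_sum) (intro integrable_inner_square hM dG h2 d2)
    ultimately have "(\<integral>w. (norm (h w + D w))\<^sup>2 \<partial>M) = (\<integral>w. (norm (h w))\<^sup>2 \<partial>M) + (\<integral>w. (norm (D w))\<^sup>2 \<partial>M)"
      using integral_norm_square_add(2)[OF hM DM h2 True] by simp
    then show ?thesis
      using h2 True integral_norm_square_add(1)[OF hM DM h2 True]
      by (simp add: second_moment_def nn_integral_eq_integral)
  qed
  then show ?thesis1
    using sumD unfolding split h_def by simp
qed

end

subsection \<open>Score functions along independent episodes\<close>

lemma gradient_eq:
  assumes "GDERIV f th :> D"
  shows "gradient f th = D"
  unfolding gradient_def
proof (rule the_equality)
  show "GDERIV f th :> D" by (rule assms)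
  fix D' assume "GDERIV f th :> D'"
  then have "(\<lambda>h. h \<bullet> D') = (\<lambda>h. h \<bullet> D)"
    using assms unfolding gderiv_def by (rule has_derivative_unique)
  then have "h \<bullet> D' = h \<bullet> D" for h
    by (rule fun_cong)
  then show "D' = D"
    using vector_eq_ldot by blast
qed

text \<open>Riesz representation in finite dimension: the derivative \<open>f'\<close> is the inner
  product with \<open>adjoint f' 1\<close>.\<close>

lemma GDERIV_gradient:
  fixes f :: "'p::euclidean_space \<Rightarrow> real"
  assumes "f differentiable (at th)"
  shows "GDERIV f th :> gradient f th"
proof -
  obtain f' where f': "(f has_derivative f') (at th)"
    using assms by (auto simp: differentiable_def)
  then have "linear f'"
    by (simp add: has_derivative_linear)
  then have "(\<lambda>h. h \<bullet> adjoint f' 1) = f'"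
    by (simp add: adjoint_works)
  with f' have "GDERIV f th :> adjoint f' 1"
    unfolding gderiv_def by simp
  then show ?thesis
    using gradient_eq by metis
qed

(* At a zero of the nonnegative density, theta is a minimum, so the gradient vanishes there and the
   unspecified value of the score does not matter. *)

lemma density_times_score:
  fixes p :: "'p::euclidean_space \<Rightarrow> 's \<Rightarrow> 'a \<Rightarrow> real"
  assumes nonneg: "\<And>th'. 0 \<le> p th' s a" and diff: "(\<lambda>th'. p th' s a) differentiable (at th)"
  shows "p th s a *\<^sub>R score p th s a = gradient (\<lambda>th'. p th' s a) th"
proof -
  note D = GDERIV_gradient[OF diff]
  show ?thesis
  proof (cases "p th s a = 0")
    case True
    have "(\<lambda>h. h \<bullet> gradient (\<lambda>th'. p th' s a) th) = (\<lambda>h. 0)"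
      by (rule has_derivative_local_min[OF D[unfolded gderiv_def]]) (simp add: True nonneg)
    then have "gradient (\<lambda>th'. p th' s a) th \<bullet> gradient (\<lambda>th'. p th' s a) th = 0"
      by (rule fun_cong)
    then show ?thesis
      by (simp add: True)
  next
    case False
    then have pos: "0 < p th s a"
      using nonneg[of th] by simp
    have "GDERIV (\<lambda>th'. ln (p th' s a)) th :> inverse (p th s a) *\<^sub>R gradient (\<lambda>th'. p th' s a) th"
      by (rule GDERIV_DERIV_compose[OF D DERIV_ln[OF pos]])
    then have "score p th s a = inverse (p th s a) *\<^sub>R gradient (\<lambda>th'. p th' s a) th"
      unfolding score_def by (rule gradient_eq)
    with False show ?thesis by simp
  qed
qed

text \<open>The total mass of the policy is 1 for every parameter, so its gradient is 0. The
  interchange in \<open>regular_policy\<close> gives a second expression for the same gradient, and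
  gradients are unique.\<close>

lemma integral_density_times_score:
  fixes p :: "'p::euclidean_space \<Rightarrow> 's \<Rightarrow> 'a \<Rightarrow> real"
  assumes pol: "policy_family S A p" and reg: "regular_policy S A p th" and s: "s \<in> space S"
  shows "(\<integral>a. p th s a *\<^sub>R score p th s a \<partial>A) = 0"
proof -
  have nonneg: "0 \<le> p th' s a" if "a \<in> space A" for th' a
    using pol s that unfolding policy_family_def by blast
  have meas: "(\<lambda>(s, a). p th' s a) \<in> borel_measurable (S \<Otimes>\<^sub>M A)" for th'
    using pol unfolding policy_family_def by blast
  have "(\<integral>a. p th' s a \<partial>A) = 1" for th'
  proof (rule integral_eq_nn_integral[THEN trans])
    show "(\<lambda>a. p th' s a) \<in> borel_measurable A"
      using measurable_compose[OF measurable_Pair1'[OF s] meas] by simp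
    have "(\<integral>\<^sup>+ a. ennreal (p th' s a) \<partial>A) = 1"
      using pol s unfolding policy_family_def by blast
    then show "enn2real (\<integral>\<^sup>+ a. ennreal (p th' s a) \<partial>A) = 1"
      by simp
    show "AE a in A. 0 \<le> p th' s a"
      by (rule AE_I2) (rule nonneg)
  qed
  then have "(\<lambda>th'. \<integral>a. p th' s a \<partial>A) = (\<lambda>th'. 1)"
    by (rule ext)
  then have "GDERIV (\<lambda>th'. \<integral>a. p th' s a \<partial>A) th :> 0"
    by (simp only: GDERIV_const)
  then have "0 = gradient (\<lambda>th'. \<integral>a. p th' s a \<partial>A) th"
    by (rule gradient_eq[symmetric])
  also have "gradient (\<lambda>th'. \<integral>a. p th' s a \<partial>A) th = (\<integral>a. gradient (\<lambda>th'. p th' s a) th \<partial>A)"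
    by (rule gradient_eq) (use reg s in \<open>unfold regular_policy_def, blast\<close>)
  also have "\<dots> = (\<integral>a. p th s a *\<^sub>R score p th s a \<partial>A)"
  proof (rule Bochner_Integration.integral_cong[OF refl])
    fix a assume "a \<in> space A"
    then have "(\<lambda>th'. p th' s a) differentiable (at th)" "\<And>th'. 0 \<le> p th' s a"
      using reg s nonneg unfolding regular_policy_def by blast+
    then show "gradient (\<lambda>th'. p th' s a) th = p th s a *\<^sub>R score p th s a"
      by (rule density_times_score[symmetric, rotated])
  qed
  finally show ?thesis by (rule sym)
qed

section \<open>Measurability of histories and of whole trajectories\<close>

lemma measurable_history:
  assumes "\<And>k. k \<in> {1..t} \<Longrightarrow> s k \<in> N \<rightarrow>\<^sub>M S"
    and "\<And>k. k \<in> {1..<t} \<Longrightarrow> a k \<in> N \<rightarrow>\<^sub>M A" "\<And>k. k \<in> {1..<t} \<Longrightarrow> r k \<in> borel_measurable N"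
  shows "history s a r t \<in> N \<rightarrow>\<^sub>M history_space S A t"
  unfolding history_def[abs_def] history_space_def
  by (intro measurable_Pair measurable_restrict assms)

lemma measurable_whole_trajectory:
  assumes "\<And>k. k \<in> {1..T} \<Longrightarrow> s k \<in> N \<rightarrow>\<^sub>M S"
    and "\<And>k. k \<in> {1..T} \<Longrightarrow> a k \<in> N \<rightarrow>\<^sub>M A" "\<And>k. k \<in> {1..T} \<Longrightarrow> r k \<in> borel_measurable N"
  shows "whole_trajectory T s a r \<in> N \<rightarrow>\<^sub>M trajectory_space S A T"
  unfolding whole_trajectory_def[abs_def] trajectory_space_def
  by (intro measurable_Pair measurable_restrict assms)

lemma measurable_history_components:
  assumes "history s a r t \<in> N \<rightarrow>\<^sub>M history_space S A t"
  shows "\<And>k. k \<in> {1..t} \<Longrightarrow> s k \<in> N \<rightarrow>\<^sub>M S"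
    and "\<And>k. k \<in> {1..<t} \<Longrightarrow> a k \<in> N \<rightarrow>\<^sub>M A" and "\<And>k. k \<in> {1..<t} \<Longrightarrow> r k \<in> borel_measurable N"
proof -
  note h = assms[unfolded history_space_def]
  show "s k \<in> N \<rightarrow>\<^sub>M S" if "k \<in> {1..t}" for k
    using measurable_compose[OF measurable_compose[OF h measurable_fst] measurable_component_singleton[OF that]] that
    by (simp add: history_def)
  show "a k \<in> N \<rightarrow>\<^sub>M A" if "k \<in> {1..<t}" for k
    using measurable_compose[OF measurable_compose[OF measurable_compose[OF h measurable_snd] measurable_fst]
        measurable_component_singleton[OF that]] that
    by (simp add: history_def)
  show "r k \<in> borel_measurable N" if "k \<in> {1..<t}" for k
    using measurable_compose[OF measurable_compose[OF measurable_compose[OF h measurable_snd] measurable_snd]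
        measurable_component_singleton[OF that]] that
    by (simp add: history_def)
qed

lemma measurable_trajectory_components:
  assumes "whole_trajectory T s a r \<in> N \<rightarrow>\<^sub>M trajectory_space S A T" and k: "k \<in> {1..T}"
  shows "s k \<in> N \<rightarrow>\<^sub>M S" "a k \<in> N \<rightarrow>\<^sub>M A" "r k \<in> borel_measurable N"
proof -
  note h = assms(1)[unfolded trajectory_space_def]
  show "s k \<in> N \<rightarrow>\<^sub>M S"
    using measurable_compose[OF measurable_compose[OF h measurable_fst] measurable_component_singleton[OF k]] k
    by (simp add: whole_trajectory_def)
  show "a k \<in> N \<rightarrow>\<^sub>M A"
    using measurable_compose[OF measurable_compose[OF measurable_compose[OF h measurable_snd] measurable_fst]
        measurable_component_singleton[OF k]] k
    by (simp add: whole_trajectory_def)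
  show "r k \<in> borel_measurable N"
    using measurable_compose[OF measurable_compose[OF measurable_compose[OF h measurable_snd] measurable_snd]
        measurable_component_singleton[OF k]] k
    by (simp add: whole_trajectory_def)
qed

section \<open>Conditional mean zero of the scores, and orthogonality for a deterministic choice of
  transitions\<close>

locale policy_episodes = prob_space M + actions: sigma_finite_measure A
  for M :: "'w measure" and A :: "'a measure" +
  fixes S :: "'s measure" and \<pi> :: "'p::euclidean_space \<Rightarrow> 's \<Rightarrow> 'a \<Rightarrow> real" and \<theta> :: 'p
    and K :: "'s \<times> 'a \<Rightarrow> (real \<times> 's) measure" and T E :: nat
    and s :: "nat \<Rightarrow> nat \<Rightarrow> 'w \<Rightarrow> 's" and a :: "nat \<Rightarrow> nat \<Rightarrow> 'w \<Rightarrow> 'a" and r :: "nat \<Rightarrow> nat \<Rightarrow> 'w \<Rightarrow> real"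
  assumes policy: "policy_family S A \<pi>" and regular: "regular_policy S A \<pi> \<theta>"
    and episodes: "independent_episodes M S A (\<pi> \<theta>) K T E s a r"
begin

definition step_score :: "nat \<times> nat \<Rightarrow> 'w \<Rightarrow> 'p" where
  "step_score k w = score \<pi> \<theta> (s (fst k) (snd k) w) (a (fst k) (snd k) w)"

definition step_history :: "nat \<times> nat \<Rightarrow> 'w \<Rightarrow> (nat \<Rightarrow> 's) \<times> (nat \<Rightarrow> 'a) \<times> (nat \<Rightarrow> real)" where
  "step_history k = history (s (fst k)) (a (fst k)) (r (fst k)) (snd k)"

text \<open>The transition's own episode is cut just before its action, while all other episodes are
  kept up to their last step. Independence of the episodes makes this large past harmless, and it
  makes any ordering of the episodes usable.\<close>

definition past where
  "past k w = ((\<lambda>e\<in>{..<E} - {fst k}. whole_trajectory T (s e) (a e) (r e) w), step_history k w)"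

definition past_space where
  "past_space k =
    (\<Pi>\<^sub>M e\<in>{..<E} - {fst k}. trajectory_space S A T) \<Otimes>\<^sub>M history_space S A (snd k)"

definition past_algebra where
  "past_algebra k = vimage_algebra (space M) (past k) (past_space k)"

lemma trajectory: "e < E \<Longrightarrow> trajectory M S A (\<pi> \<theta>) K T (s e) (a e) (r e)"
  using episodes by (auto simp: independent_episodes_def)

lemma component_measurable:
  assumes "e < E" "t \<in> {1..T}"
  shows "s e t \<in> M \<rightarrow>\<^sub>M S" "a e t \<in> M \<rightarrow>\<^sub>M A" "r e t \<in> borel_measurable M"
  using trajectory[OF assms(1)] assms(2) by (auto simp: trajectory_def)

lemma score_measurable: "(\<lambda>(s, a). score \<pi> \<theta> s a) \<in> borel_measurable (S \<Otimes>\<^sub>M A)"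
  using regular by (simp add: regular_policy_def)

lemma policy_measurable: "(\<lambda>(s, a). \<pi> \<theta> s a) \<in> borel_measurable (S \<Otimes>\<^sub>M A)"
  using policy by (simp add: policy_family_def)

lemma step_score_measurable:
  assumes "s (fst k) (snd k) \<in> N \<rightarrow>\<^sub>M S" "a (fst k) (snd k) \<in> N \<rightarrow>\<^sub>M A"
  shows "step_score k \<in> borel_measurable N"
  using measurable_compose[OF measurable_Pair[OF assms] score_measurable]
  by (simp add: step_score_def[abs_def])

lemma whole_trajectory_measurable:
  "e < E \<Longrightarrow> whole_trajectory T (s e) (a e) (r e) \<in> M \<rightarrow>\<^sub>M trajectory_space S A T"
  by (intro measurable_whole_trajectory component_measurable)

lemma step_history_measurable:
  assumes "k \<in> {..<E} \<times> {1..T}"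
  shows "step_history k \<in> M \<rightarrow>\<^sub>M history_space S A (snd k)"
  unfolding step_history_def using assms by (intro measurable_history component_measurable) auto

lemma past_measurable:
  assumes "k \<in> {..<E} \<times> {1..T}"
  shows "past k \<in> M \<rightarrow>\<^sub>M past_space k"
  unfolding past_def[abs_def] past_space_def
  by (intro measurable_Pair measurable_restrict whole_trajectory_measurable step_history_measurable assms) auto

lemma subalgebra_past:
  assumes "k \<in> {..<E} \<times> {1..T}"
  shows "subalgebra M (past_algebra k)"
  unfolding subalgebra_def past_algebra_def
  by (simp add: sets_image_in_sets[OF refl past_measurable[OF assms]])

lemma past_algebra_measurable:
  assumes k: "k \<in> {..<E} \<times> {1..T}"
  shows "step_history k \<in> past_algebra k \<rightarrow>\<^sub>M history_space S A (snd k)"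
    and "\<And>e. e < E \<Longrightarrow> e \<noteq> fst k \<Longrightarrow>
      whole_trajectory T (s e) (a e) (r e) \<in> past_algebra k \<rightarrow>\<^sub>M trajectory_space S A T"
proof -
  have p: "past k \<in> past_algebra k \<rightarrow>\<^sub>M past_space k"
    unfolding past_algebra_def
    by (rule measurable_vimage_algebra1) (use measurable_space[OF past_measurable[OF k]] in auto)
  note p = p[unfolded past_space_def]
  show "step_history k \<in> past_algebra k \<rightarrow>\<^sub>M history_space S A (snd k)"
    using measurable_compose[OF p measurable_snd] by (simp add: past_def)
  show "whole_trajectory T (s e) (a e) (r e) \<in> past_algebra k \<rightarrow>\<^sub>M trajectory_space S A T"
    if "e < E" "e \<noteq> fst k" for e
    using measurable_compose[OF measurable_compose[OF p measurable_fst] measurable_component_singleton[of e]] that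
    by (simp add: past_def)
qed

text \<open>The joint law of history and action has the policy as density with respect to the
  product with \<open>A\<close>. By Fubini the action is integrated first, and for a fixed history
  the inner integral is a multiple of the integral of density times score, which is 0.\<close>

lemma integral_score_given_history:
  assumes k: "k \<in> {..<E} \<times> {1..T}" and C: "C \<in> sets (history_space S A (snd k))"
    and int: "integrable M (step_score k)"
  defines "L \<equiv> distr M (history_space S A (snd k) \<Otimes>\<^sub>M A) (\<lambda>w. (step_history k w, a (fst k) (snd k) w))"
  shows "(\<integral>(h, x). indicator C h *\<^sub>R score \<pi> \<theta> (fst h (snd k)) x \<partial>L) = 0"
proof -
  obtain e t where kk: "k = (e, t)" and e: "e < E" and t: "t \<in> {1..T}"
    using k by auto
  let ?H = "history_space S A t"
  let ?hist = "step_history k"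
  define R where "R = distr M ?H ?hist"
  have hist [measurable]: "?hist \<in> M \<rightarrow>\<^sub>M ?H"
    using step_history_measurable[OF k] kk by simp
  have aM [measurable]: "a e t \<in> M \<rightarrow>\<^sub>M A"
    by (rule component_measurable[OF e t])
  have X: "(\<lambda>w. (?hist w, a e t w)) \<in> M \<rightarrow>\<^sub>M ?H \<Otimes>\<^sub>M A" by measurable
  have fst_state: "(\<lambda>h. fst h t) \<in> ?H \<rightarrow>\<^sub>M S"
    unfolding history_space_def
    by (rule measurable_compose[OF measurable_fst measurable_component_singleton]) (use t in auto)
  have state: "(\<lambda>(h, x). (fst h t, x)) \<in> ?H \<Otimes>\<^sub>M A \<rightarrow>\<^sub>M S \<Otimes>\<^sub>M A"
    unfolding split_beta
    by (intro measurable_Pair measurable_snd measurable_compose[OF measurable_fst fst_state])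
  have p: "(\<lambda>(h, x). \<pi> \<theta> (fst h t) x) \<in> borel_measurable (?H \<Otimes>\<^sub>M A)"
    using measurable_compose[OF state policy_measurable] by (simp add: split_beta)
  have sc: "(\<lambda>(h, x). score \<pi> \<theta> (fst h t) x) \<in> borel_measurable (?H \<Otimes>\<^sub>M A)"
    using measurable_compose[OF state score_measurable] by (simp add: split_beta)
  have Csets [measurable]: "C \<in> sets ?H" using C kk by simp
  define f where "f = (\<lambda>(h, x). indicator C h *\<^sub>R score \<pi> \<theta> (fst h t) x)"
  have f [measurable]: "f \<in> borel_measurable (?H \<Otimes>\<^sub>M A)"
    using sc unfolding f_def split_beta by measurable
  have setsR [simp, measurable_cong]: "sets R = sets ?H" and spaceR [simp]: "space R = space ?H"
    by (simp_all add: R_def)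
  have pair_sets: "sets (R \<Otimes>\<^sub>M A) = sets (?H \<Otimes>\<^sub>M A)"
    by (rule sets_pair_measure_cong) simp_all
  note meas_R = measurable_cong_sets[OF pair_sets refl]
  have L: "L = density (R \<Otimes>\<^sub>M A) (\<lambda>(h, x). ennreal (\<pi> \<theta> (fst h t) x))"
    using trajectory[OF e] t unfolding trajectory_def L_def R_def kk step_history_def by simp
  interpret R: prob_space R
    unfolding R_def by (rule prob_space_distr) simp
  interpret RA: pair_sigma_finite R A ..
  have nonneg: "AE z in R \<Otimes>\<^sub>M A. 0 \<le> (case z of (h, x) \<Rightarrow> \<pi> \<theta> (fst h t) x)"
    using policy measurable_space[OF fst_state]
    by (intro AE_I2) (auto simp: policy_family_def space_pair_measure)
  have L': "L = density (R \<Otimes>\<^sub>M A) (\<lambda>z. ennreal (case z of (h, x) \<Rightarrow> \<pi> \<theta> (fst h t) x))"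
    unfolding L by (simp add: split_beta')
  have fR: "f \<in> borel_measurable (R \<Otimes>\<^sub>M A)" and pR: "(\<lambda>(h, x). \<pi> \<theta> (fst h t) x) \<in> borel_measurable (R \<Otimes>\<^sub>M A)"
    using f p by (simp_all add: meas_R)
  have "integrable M (\<lambda>w. indicator (?hist -` C \<inter> space M) w *\<^sub>R step_score k w)"
    by (rule integrable_mult_indicator[OF _ int]) measurable
  then have "integrable M (\<lambda>w. f (?hist w, a e t w))"
    by (rule Bochner_Integration.integrable_cong[THEN iffD1, rotated 2])
      (use t in \<open>auto simp: f_def step_score_def step_history_def history_def kk split: split_indicator\<close>)
  then have "integrable L f"
    unfolding L_def kk by (subst integrable_distr_eq) (use f X in \<open>auto simp: kk\<close>)
  then have int_f: "integrable (R \<Otimes>\<^sub>M A) (\<lambda>z. (case z of (h, x) \<Rightarrow> \<pi> \<theta> (fst h t) x) *\<^sub>R f z)"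
    unfolding L' integrable_density[OF fR pR nonneg] .
  have "(\<integral>z. f z \<partial>L) = (\<integral>z. (case z of (h, x) \<Rightarrow> \<pi> \<theta> (fst h t) x) *\<^sub>R f z \<partial>(R \<Otimes>\<^sub>M A))"
    unfolding L' by (rule integral_density[OF fR pR nonneg])
  also have "\<dots> = (\<integral>h. (\<integral>x. \<pi> \<theta> (fst h t) x *\<^sub>R f (h, x) \<partial>A) \<partial>R)"
    using RA.integral_fst'[OF int_f] by simp
  also have "\<dots> = (\<integral>h. 0 \<partial>R)"
  proof (rule Bochner_Integration.integral_cong[OF refl])
    fix h assume "h \<in> space R"
    then have "fst h t \<in> space S"
      using measurable_space[OF fst_state] by simp
    from integral_density_times_score[OF policy regular this]
    show "(\<integral>x. \<pi> \<theta> (fst h t) x *\<^sub>R f (h, x) \<partial>A) = 0"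
      by (cases "h \<in> C") (simp_all add: f_def)
  qed
  finally show ?thesis by (simp add: f_def kk)
qed

text \<open>Independence turns the joint law of the other episodes and the own episode into a
  product. With the other episodes frozen, an event of the past becomes an event of the own history,
  to which the single-episode statement applies.\<close>

lemma integral_score_given_past:
  assumes k: "k \<in> {..<E} \<times> {1..T}" and int: "integrable M (step_score k)"
    and B: "B \<in> sets (past_algebra k)"
  shows "(\<integral>w. indicator B w *\<^sub>R step_score k w \<partial>M) = 0"
proof -
  obtain e t where kk: "k = (e, t)" and e: "e < E" and t: "t \<in> {1..T}"
    using k by auto
  let ?H = "history_space S A t" and ?J = "{..<E} - {e}" and ?Tr = "trajectory_space S A T"
  let ?Y = "\<lambda>w. \<lambda>e'\<in>?J. whole_trajectory T (s e') (a e') (r e') w"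
  \<comment> \<open>Kept as a family over a singleton, the form in which independence of two
    disjoint blocks of episodes is available.\<close>
  let ?Z = "\<lambda>w. \<lambda>e'\<in>{e}. whole_trajectory T (s e') (a e') (r e') w"
  let ?X = "\<lambda>w. (step_history k w, a e t w)"
  have hist [measurable]: "step_history k \<in> M \<rightarrow>\<^sub>M ?H"
    using step_history_measurable[OF k] kk by simp
  have aM [measurable]: "a e t \<in> M \<rightarrow>\<^sub>M A"
    by (rule component_measurable[OF e t])
  obtain B' where B': "B' \<in> sets (past_space k)" "B = past k -` B' \<inter> space M"
    using B measurable_space[OF past_measurable[OF k]]
    unfolding past_algebra_def by (subst (asm) sets_vimage_algebra2) auto
  have indep: "indep_vars (\<lambda>e. ?Tr) (\<lambda>e. whole_trajectory T (s e) (a e) (r e)) {..<E}"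
    using episodes by (simp add: independent_episodes_def)
  \<comment> \<open>Independence concerns whole trajectories, so the history and action at time
    \<open>t\<close> are recovered from the own trajectory by a measurable map.\<close>
  define \<phi> where "\<phi> f = (case f e of (u, v, z) \<Rightarrow>
      ((restrict u {1..t}, restrict v {1..<t}, restrict z {1..<t}), v t))"
    for f :: "nat \<Rightarrow> (nat \<Rightarrow> 's) \<times> (nat \<Rightarrow> 'a) \<times> (nat \<Rightarrow> real)"
  have \<phi>: "\<phi> \<in> (\<Pi>\<^sub>M e'\<in>{e}. ?Tr) \<rightarrow>\<^sub>M ?H \<Otimes>\<^sub>M A"
  proof -
    have c: "(\<lambda>f. f e) \<in> (\<Pi>\<^sub>M e'\<in>{e}. ?Tr) \<rightarrow>\<^sub>M ?Tr"
      by (rule measurable_component_singleton) simp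
    have [measurable]:
      "(\<lambda>u. restrict u {1..t}) \<in> (\<Pi>\<^sub>M k\<in>{1..T}. S) \<rightarrow>\<^sub>M (\<Pi>\<^sub>M k\<in>{1..t}. S)"
      "(\<lambda>u. restrict u {1..<t}) \<in> (\<Pi>\<^sub>M k\<in>{1..T}. A) \<rightarrow>\<^sub>M (\<Pi>\<^sub>M k\<in>{1..<t}. A)"
      "(\<lambda>u. restrict u {1..<t}) \<in> (\<Pi>\<^sub>M k\<in>{1..T}. borel) \<rightarrow>\<^sub>M (\<Pi>\<^sub>M k\<in>{1..<t}. (borel :: real measure))"
      "(\<lambda>v. v t) \<in> (\<Pi>\<^sub>M k\<in>{1..T}. A) \<rightarrow>\<^sub>M A"
      using t by (auto intro: measurable_restrict_subset measurable_component_singleton)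
    have "(\<lambda>(u, v, z). ((restrict u {1..t}, restrict v {1..<t}, restrict z {1..<t}), v t)) \<in> ?Tr \<rightarrow>\<^sub>M ?H \<Otimes>\<^sub>M A"
      unfolding trajectory_space_def history_space_def by measurable
    from measurable_compose[OF c this] show ?thesis
      by (simp add: \<phi>_def[abs_def])
  qed
  have \<phi>Z: "\<phi> (?Z w) = ?X w" for w
    using t by (auto simp: \<phi>_def whole_trajectory_def step_history_def history_def kk fun_eq_iff)
  have iv: "indep_var (\<Pi>\<^sub>M e'\<in>?J. ?Tr) ?Y (\<Pi>\<^sub>M e'\<in>{e}. ?Tr) ?Z"
    by (rule indep_var_restrict[OF indep]) (use e in auto)
  define P Q where "P = distr M (\<Pi>\<^sub>M e'\<in>?J. ?Tr) ?Y" and "Q = distr M (\<Pi>\<^sub>M e'\<in>{e}. ?Tr) ?Z"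
  have Y: "?Y \<in> M \<rightarrow>\<^sub>M (\<Pi>\<^sub>M e'\<in>?J. ?Tr)" and Z: "?Z \<in> M \<rightarrow>\<^sub>M (\<Pi>\<^sub>M e'\<in>{e}. ?Tr)"
    using iv by (blast dest: indep_var_rv1 indep_var_rv2)+
  have X: "?X \<in> M \<rightarrow>\<^sub>M ?H \<Otimes>\<^sub>M A" by measurable
  have PQ: "P \<Otimes>\<^sub>M Q = distr M ((\<Pi>\<^sub>M e'\<in>?J. ?Tr) \<Otimes>\<^sub>M (\<Pi>\<^sub>M e'\<in>{e}. ?Tr)) (\<lambda>w. (?Y w, ?Z w))"
    using iv unfolding indep_var_distribution_eq P_def Q_def by simp
  interpret P: prob_space P unfolding P_def by (rule prob_space_distr[OF Y])
  interpret Q: prob_space Q unfolding Q_def by (rule prob_space_distr[OF Z])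
  interpret PQ: pair_sigma_finite P Q ..
  define F where "F = (\<lambda>(y, h, x). indicator B' (y, h) *\<^sub>R score \<pi> \<theta> (fst h t) x)"
  have fst_state: "(\<lambda>h. fst h t) \<in> ?H \<rightarrow>\<^sub>M S"
    unfolding history_space_def
    by (rule measurable_compose[OF measurable_fst measurable_component_singleton]) (use t in auto)
  have B'2: "B' \<in> sets ((\<Pi>\<^sub>M e'\<in>?J. ?Tr) \<Otimes>\<^sub>M ?H)"
    using B'(1) by (simp add: past_space_def kk)
  have F: "F \<in> borel_measurable ((\<Pi>\<^sub>M e'\<in>?J. ?Tr) \<Otimes>\<^sub>M (?H \<Otimes>\<^sub>M A))"
  proof -
    have "(\<lambda>z. (fst z, fst (snd z))) \<in> (\<Pi>\<^sub>M e'\<in>?J. ?Tr) \<Otimes>\<^sub>M (?H \<Otimes>\<^sub>M A) \<rightarrow>\<^sub>M (\<Pi>\<^sub>M e'\<in>?J. ?Tr) \<Otimes>\<^sub>M ?H"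
      by measurable
    then have 1: "(\<lambda>z. indicator B' (fst z, fst (snd z)) :: real) \<in>
        borel_measurable ((\<Pi>\<^sub>M e'\<in>?J. ?Tr) \<Otimes>\<^sub>M (?H \<Otimes>\<^sub>M A))"
      by (rule measurable_compose) (use B'2 in measurable)
    have "(\<lambda>z. (fst (fst (snd z)) t, snd (snd z))) \<in>
        (\<Pi>\<^sub>M e'\<in>?J. ?Tr) \<Otimes>\<^sub>M (?H \<Otimes>\<^sub>M A) \<rightarrow>\<^sub>M S \<Otimes>\<^sub>M A"
      by (intro measurable_Pair measurable_compose[OF _ fst_state]) measurable
    from measurable_compose[OF this score_measurable] 1 show ?thesis
      unfolding F_def split_beta by (intro borel_measurable_scaleR) (simp_all add: split_beta)
  qed
  have FM: "F (?Y w, ?X w) = indicator B w *\<^sub>R step_score k w" if "w \<in> space M" for w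
    using that t by (auto simp: F_def B' past_def kk step_score_def step_history_def history_def indicator_def)
  have BM: "B \<in> sets M"
    using B subalgebra_past[OF k] by (auto simp: subalgebra_def)
  have YZ: "(\<lambda>w. (?Y w, ?Z w)) \<in> M \<rightarrow>\<^sub>M (\<Pi>\<^sub>M e'\<in>?J. ?Tr) \<Otimes>\<^sub>M (\<Pi>\<^sub>M e'\<in>{e}. ?Tr)"
    by (rule measurable_Pair[OF Y Z])
  have "(\<lambda>z. (fst z, \<phi> (snd z))) \<in>
      (\<Pi>\<^sub>M e'\<in>?J. ?Tr) \<Otimes>\<^sub>M (\<Pi>\<^sub>M e'\<in>{e}. ?Tr) \<rightarrow>\<^sub>M (\<Pi>\<^sub>M e'\<in>?J. ?Tr) \<Otimes>\<^sub>M (?H \<Otimes>\<^sub>M A)"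
    by (intro measurable_Pair measurable_fst measurable_compose[OF measurable_snd \<phi>])
  from measurable_compose[OF this F]
  have F\<phi>: "(\<lambda>z. F (fst z, \<phi> (snd z))) \<in>
      borel_measurable ((\<Pi>\<^sub>M e'\<in>?J. ?Tr) \<Otimes>\<^sub>M (\<Pi>\<^sub>M e'\<in>{e}. ?Tr))" .
  have "integrable M (\<lambda>w. indicator B w *\<^sub>R step_score k w)"
    by (rule integrable_mult_indicator[OF BM int])
  then have "integrable M (\<lambda>w. F (?Y w, ?X w))"
    by (rule Bochner_Integration.integrable_cong[THEN iffD1, rotated 2]) (simp_all add: FM)
  then have int_F: "integrable (P \<Otimes>\<^sub>M Q) (\<lambda>z. F (fst z, \<phi> (snd z)))"
    unfolding PQ integrable_distr_eq[OF YZ F\<phi>] by (simp only: fst_conv snd_conv \<phi>Z)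
  have "(\<integral>w. indicator B w *\<^sub>R step_score k w \<partial>M) = (\<integral>w. F (?Y w, ?X w) \<partial>M)"
    by (rule Bochner_Integration.integral_cong) (simp_all add: FM)
  also have "\<dots> = (\<integral>z. F (fst z, \<phi> (snd z)) \<partial>(P \<Otimes>\<^sub>M Q))"
    unfolding PQ integral_distr[OF YZ F\<phi>] by (simp only: fst_conv snd_conv \<phi>Z)
  also have "\<dots> = (\<integral>y. (\<integral>z. F (y, \<phi> z) \<partial>Q) \<partial>P)"
    using PQ.integral_fst'[OF int_F] by simp
  also have "\<dots> = (\<integral>y. 0 \<partial>P)"
  proof (rule Bochner_Integration.integral_cong[OF refl])
    fix y assume "y \<in> space P"
    then have y: "y \<in> space (\<Pi>\<^sub>M e'\<in>?J. ?Tr)" by (simp add: P_def)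
    have C: "Pair y -` B' \<in> sets (history_space S A (snd k))"
      using sets_Pair1[OF B'2] by (simp add: kk)
    have Fy: "(\<lambda>z. F (y, z)) \<in> borel_measurable (?H \<Otimes>\<^sub>M A)"
      by (rule measurable_compose[OF measurable_Pair1'[OF y] F])
    have "(\<integral>z. F (y, \<phi> z) \<partial>Q) = (\<integral>w. F (y, ?X w) \<partial>M)"
      unfolding Q_def by (subst integral_distr[OF Z measurable_compose[OF \<phi> Fy]]) (simp only: \<phi>Z)
    also have "\<dots> = (\<integral>z. F (y, z) \<partial>distr M (?H \<Otimes>\<^sub>M A) ?X)"
      by (rule integral_distr[OF X Fy, symmetric])
    also have "\<dots> = 0"
      using integral_score_given_history[OF k C int]
      by (simp add: F_def kk indicator_def split_beta')
    finally show "(\<integral>z. F (y, \<phi> z) \<partial>Q) = 0" .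
  qed
  finally show ?thesis by simp
qed

text \<open>Lexicographic order as a number: the base \<open>Suc T\<close> exceeds every timestep in
  {1..T}, so episode and time are quotient and remainder.\<close>

definition rank :: "nat \<times> nat \<Rightarrow> nat" where
  "rank k = fst k * Suc T + snd k"

lemma rank_less_cases:
  assumes "j \<in> {..<E} \<times> {1..T}" "k \<in> {..<E} \<times> {1..T}" "rank j < rank k"
  shows "fst j < fst k \<or> fst j = fst k \<and> snd j < snd k"
proof (rule ccontr)
  assume *: "\<not> ?thesis"
  have le: "snd k \<le> T" using assms by auto
  consider "fst j > fst k" | "fst j = fst k" "snd k \<le> snd j"
    using * by linarith
  then show False
  proof cases
    case 1
    then have "Suc (fst k) * Suc T \<le> fst j * Suc T"
      by (intro mult_le_mono1) simp
    with assms(3) le show False by (simp add: rank_def)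
  qed (use assms(3) in \<open>simp add: rank_def\<close>)
qed

lemma inj_on_rank: "inj_on rank ({..<E} \<times> {1..T})"
proof (rule inj_onI)
  fix j k assume j: "j \<in> {..<E} \<times> {1..T}" and k: "k \<in> {..<E} \<times> {1..T}" and eq: "rank j = rank k"
  have "snd j < Suc T" "snd k < Suc T" using j k by auto
  moreover have "rank i div Suc T = fst i" "rank i mod Suc T = snd i" if "snd i < Suc T" for i
    using that unfolding rank_def by (simp_all del: mult_Suc_right)
  ultimately show "j = k" using eq by (metis prod_eq_iff)
qed

text \<open>Supplies the measurability of earlier terms. A transition of another episode lies in the
  past as part of a whole trajectory; one of the same episode occurs at an earlier time and is part
  of the history.\<close>

lemma step_measurable_past:
  assumes j: "j \<in> {..<E} \<times> {1..T}" and k: "k \<in> {..<E} \<times> {1..T}" and less: "rank j < rank k"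
  shows "step_history j \<in> past_algebra k \<rightarrow>\<^sub>M history_space S A (snd j)"
    and "step_score j \<in> borel_measurable (past_algebra k)"
proof -
  note past = past_algebra_measurable[OF k]
  note hk = measurable_history_components[OF past(1)[unfolded step_history_def]]
  have *: "(\<forall>i\<in>{1..snd j}. s (fst j) i \<in> past_algebra k \<rightarrow>\<^sub>M S) \<and>
      (\<forall>i\<in>{1..snd j}. a (fst j) i \<in> past_algebra k \<rightarrow>\<^sub>M A) \<and>
      (\<forall>i\<in>{1..snd j}. r (fst j) i \<in> borel_measurable (past_algebra k))"
  proof (cases "fst j = fst k")
    case True
    \<comment> \<open>Strictness matters: the history up to the state at time \<open>snd k\<close>
      contains actions only at smaller times, and the score of \<open>j\<close> depends on its
      action.\<close>
    then have "snd j < snd k" using rank_less_cases[OF j k less] by simp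
    with True hk show ?thesis by auto
  next
    case False
    then show ?thesis
      using measurable_trajectory_components[OF past(2)[of "fst j"]] j by auto
  qed
  show "step_history j \<in> past_algebra k \<rightarrow>\<^sub>M history_space S A (snd j)"
    unfolding step_history_def using * by (intro measurable_history) auto
  show "step_score j \<in> borel_measurable (past_algebra k)"
    using * j by (intro step_score_measurable) auto
qed

text \<open>The positions in \<open>I\<close> may list the transitions in any order; the summation
  order is that of \<open>rank\<close> composed with \<open>\<sigma>\<close>, which is injective
  because no transition is repeated.\<close>

lemma nn_integral_step_scores_orthogonal:
  assumes "finite I" and \<sigma>: "\<sigma> ` I \<subseteq> {..<E} \<times> {1..T}" "inj_on \<sigma> I"
    and int: "\<And>i. i \<in> I \<Longrightarrow> integrable M (\<lambda>w. (norm (step_score (\<sigma> i) w))\<^sup>2)"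
    and c: "\<And>i. i \<in> I \<Longrightarrow> c i \<in> borel_measurable (history_space S A (snd (\<sigma> i)))"
  shows "(\<integral>\<^sup>+ w. ennreal ((norm (\<Sum>i\<in>I. c i (step_history (\<sigma> i) w) *\<^sub>R step_score (\<sigma> i) w))\<^sup>2) \<partial>M) =
    (\<Sum>i\<in>I. \<integral>\<^sup>+ w. ennreal ((norm (c i (step_history (\<sigma> i) w) *\<^sub>R step_score (\<sigma> i) w))\<^sup>2) \<partial>M)"
proof (rule nn_integral_norm_square_sum_orthogonal[where N = "\<lambda>i. past_algebra (\<sigma> i)" and rank = "rank \<circ> \<sigma>"])
  have \<sigma>I: "\<sigma> i \<in> {..<E} \<times> {1..T}" if "i \<in> I" for i using \<sigma> that by blast
  show "inj_on (rank \<circ> \<sigma>) I"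
    using \<sigma> inj_on_rank by (intro comp_inj_on) (auto intro: inj_on_subset)
  show "subalgebra M (past_algebra (\<sigma> i))" if "i \<in> I" for i
    by (rule subalgebra_past[OF \<sigma>I[OF that]])
  show meas: "step_score (\<sigma> i) \<in> borel_measurable M" if "i \<in> I" for i
    using \<sigma>I[OF that] by (intro step_score_measurable component_measurable) auto
  show "(\<integral>w. indicator B w *\<^sub>R step_score (\<sigma> i) w \<partial>M) = 0"
    if "i \<in> I" "B \<in> sets (past_algebra (\<sigma> i))" for i B
    by (rule integral_score_given_past[OF \<sigma>I[OF that(1)] square_integrable_norm_imp_integrable[OF meas[OF that(1)] int[OF that(1)]] that(2)])
  show "(\<lambda>w. c i (step_history (\<sigma> i) w)) \<in> borel_measurable (past_algebra (\<sigma> i))" if "i \<in> I" for i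
    by (rule measurable_compose[OF past_algebra_measurable(1)[OF \<sigma>I[OF that]] c[OF that]])
  show "(\<lambda>w. c i (step_history (\<sigma> i) w) *\<^sub>R step_score (\<sigma> i) w) \<in> borel_measurable (past_algebra (\<sigma> j))"
    if "i \<in> I" "j \<in> I" "(rank \<circ> \<sigma>) i < (rank \<circ> \<sigma>) j" for i j
    using that \<sigma>I
    by (intro borel_measurable_scaleR measurable_compose[OF step_measurable_past(1) c] step_measurable_past(2)) auto
qed (use assms in auto)

end

subsection \<open>Selected transitions\<close>

text \<open>The point \<open>y0\<close> shows that the value \<open>m\<close> is attained, and
  finiteness of \<open>m\<close> allows it to be cancelled in \<open>ennreal\<close>.\<close>

lemma is_arg_min_add_const_iff:
  fixes f R :: "'y \<Rightarrow> ennreal"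
  assumes f: "\<And>y. P y \<Longrightarrow> f y = m + R y" and m: "m < \<infinity>" and y0: "P y0" "R y0 = 0" and y: "P y"
  shows "is_arg_min f P y \<longleftrightarrow> R y = 0"
proof
  assume "is_arg_min f P y"
  then have "m + R y \<le> m + 0"
    using f y y0 by (metis is_arg_min_linorder)
  then have "R y \<le> 0"
    using m by (subst (asm) ennreal_add_left_cancel_le) auto
  then show "R y = 0" by simp
next
  assume "R y = 0"
  then show "is_arg_min f P y"
    using f y by (auto simp: is_arg_min_linorder)
qed

locale selected_transitions = policy_episodes M A S \<pi> \<theta> K T E s a r
  for M :: "'w measure" and A :: "'a measure" and S :: "'s measure"
    and \<pi> :: "'p::euclidean_space \<Rightarrow> 's \<Rightarrow> 'a \<Rightarrow> real" and \<theta> K T E s a r +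
  fixes n :: nat and sel :: "nat \<Rightarrow> 'w \<Rightarrow> nat \<times> nat"
    and X :: "nat \<Rightarrow> 'x measure" and x :: "nat \<Rightarrow> nat \<Rightarrow> (nat \<Rightarrow> 's) \<times> (nat \<Rightarrow> 'a) \<times> (nat \<Rightarrow> real) \<Rightarrow> 'x"
  assumes selection: "transition_selection M S A T E s a r n sel"
    and x_measurable: "\<And>i t. i \<in> {1..n} \<Longrightarrow> t \<in> {1..T} \<Longrightarrow> x i t \<in> history_space S A t \<rightarrow>\<^sub>M X i"
    and selected_score_square_integrable:
      "\<And>i. i \<in> {1..n} \<Longrightarrow> integrable M (\<lambda>w. (norm (selected_score \<pi> \<theta> s a sel i w))\<^sup>2)"
begin

abbreviation G :: "nat \<Rightarrow> 'w \<Rightarrow> 'p" where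
  "G \<equiv> selected_score \<pi> \<theta> s a sel"

abbreviation \<xi> :: "nat \<Rightarrow> 'w \<Rightarrow> 'x" where
  "\<xi> \<equiv> selected_input x s a r sel"

definition trajectories_algebra where
  "trajectories_algebra = vimage_algebra (space M)
    (\<lambda>w. \<lambda>e\<in>{..<E}. whole_trajectory T (s e) (a e) (r e) w) (\<Pi>\<^sub>M e\<in>{..<E}. trajectory_space S A T)"

lemma sel_measurable: "i \<in> {1..n} \<Longrightarrow> sel i \<in> M \<rightarrow>\<^sub>M count_space ({..<E} \<times> {1..T})"
  using selection by (auto simp: transition_selection_def)

lemma sel_in: "i \<in> {1..n} \<Longrightarrow> w \<in> space M \<Longrightarrow> sel i w \<in> {..<E} \<times> {1..T}"
  using measurable_space[OF sel_measurable] by simp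

lemma G_eq: "G i w = step_score (sel i w) w"
  by (simp add: selected_score_def step_score_def split_beta)

lemma \<xi>_eq: "\<xi> i w = x i (snd (sel i w)) (step_history (sel i w) w)"
  by (simp add: selected_input_def step_history_def split_beta)

lemma G_measurable: "i \<in> {1..n} \<Longrightarrow> G i \<in> borel_measurable M"
  unfolding G_eq[abs_def]
  by (rule measurable_compose_countable'[OF _ sel_measurable])
    (auto intro!: step_score_measurable component_measurable)

lemma \<xi>_measurable: "i \<in> {1..n} \<Longrightarrow> \<xi> i \<in> M \<rightarrow>\<^sub>M X i"
  unfolding \<xi>_eq[abs_def]
  by (rule measurable_compose_countable'[OF _ sel_measurable])
    (auto intro!: measurable_compose[OF step_history_measurable x_measurable])

lemma trajectories_measurable:
  "(\<lambda>w. \<lambda>e\<in>{..<E}. whole_trajectory T (s e) (a e) (r e) w) \<in> M \<rightarrow>\<^sub>M (\<Pi>\<^sub>M e\<in>{..<E}. trajectory_space S A T)"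
  by (intro measurable_restrict whole_trajectory_measurable) simp

lemma subalgebra_trajectories: "subalgebra M trajectories_algebra"
  unfolding subalgebra_def trajectories_algebra_def
  by (simp add: sets_image_in_sets[OF refl trajectories_measurable])

lemma step_measurable_trajectories:
  assumes k: "k \<in> {..<E} \<times> {1..T}"
  shows "step_history k \<in> trajectories_algebra \<rightarrow>\<^sub>M history_space S A (snd k)"
    and "step_score k \<in> borel_measurable trajectories_algebra"
proof -
  have fk: "fst k \<in> {..<E}" using k by auto
  have "(\<lambda>w. \<lambda>e\<in>{..<E}. whole_trajectory T (s e) (a e) (r e) w) \<in>
      trajectories_algebra \<rightarrow>\<^sub>M (\<Pi>\<^sub>M e\<in>{..<E}. trajectory_space S A T)"
    unfolding trajectories_algebra_def
    by (rule measurable_vimage_algebra1) (use measurable_space[OF trajectories_measurable] in auto)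
  from measurable_compose[OF this measurable_component_singleton[OF fk]]
  have "whole_trajectory T (s (fst k)) (a (fst k)) (r (fst k)) \<in> trajectories_algebra \<rightarrow>\<^sub>M trajectory_space S A T"
    using fk by simp
  note components = measurable_trajectory_components[OF this]
  show "step_history k \<in> trajectories_algebra \<rightarrow>\<^sub>M history_space S A (snd k)"
    unfolding step_history_def using k by (intro measurable_history components) auto
  show "step_score k \<in> borel_measurable trajectories_algebra"
    using k by (intro step_score_measurable components) auto
qed

definition selection_event :: "(nat \<Rightarrow> nat \<times> nat) \<Rightarrow> 'w set" where
  "selection_event \<sigma> = {w \<in> space M. \<forall>i\<in>{1..n}. sel i w = \<sigma> i}"

text \<open>The event is the preimage of a single point of a finite product, so it belongs to the
  algebra of the selection, which is independent of the trajectories.\<close>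

lemma selection_event_indep:
  assumes \<sigma>: "\<sigma> \<in> {1..n} \<rightarrow>\<^sub>E {..<E} \<times> {1..T}" and f: "f \<in> borel_measurable trajectories_algebra"
  shows "selection_event \<sigma> \<in> sets M"
    and "(\<integral>\<^sup>+ w. f w * indicator (selection_event \<sigma>) w \<partial>M) =
      emeasure M (selection_event \<sigma>) * (\<integral>\<^sup>+ w. f w \<partial>M)"
proof -
  let ?sel = "\<lambda>w. \<lambda>i\<in>{1..n}. sel i w" and ?N = "\<Pi>\<^sub>M i\<in>{1..n}. count_space ({..<E} \<times> {1..T})"
  have "(\<Pi>\<^sub>E i\<in>{1..n}. {\<sigma> i}) \<in> sets ?N"
    by (intro sets_PiM_I_finite) (use PiE_mem[OF \<sigma>] in simp_all)
  then have "?sel -` (\<Pi>\<^sub>E i\<in>{1..n}. {\<sigma> i}) \<inter> space M \<in> sets (vimage_algebra (space M) ?sel ?N)"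
    by (rule in_vimage_algebra)
  moreover have "?sel -` (\<Pi>\<^sub>E i\<in>{1..n}. {\<sigma> i}) \<inter> space M = selection_event \<sigma>"
    by (auto simp: selection_event_def restrict_PiE_iff PiE_iff)
  ultimately have C: "selection_event \<sigma> \<in> sets (vimage_algebra (space M) ?sel ?N)"
    by simp
  have indep: "indep_set (sets (vimage_algebra (space M) ?sel ?N)) (sets trajectories_algebra)"
    using selection unfolding transition_selection_def trajectories_algebra_def by blast
  then show "selection_event \<sigma> \<in> sets M"
    using C unfolding indep_sets2_eq by blast
  show "(\<integral>\<^sup>+ w. f w * indicator (selection_event \<sigma>) w \<partial>M) =
      emeasure M (selection_event \<sigma>) * (\<integral>\<^sup>+ w. f w \<partial>M)"
    by (rule nn_integral_indep_indicator[OF indep subalgebra_trajectories C f])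
qed

lemma nn_integral_split_selection:
  assumes f: "f \<in> borel_measurable M"
  shows "(\<integral>\<^sup>+ w. f w \<partial>M) =
    (\<Sum>\<sigma>\<in>{1..n} \<rightarrow>\<^sub>E {..<E} \<times> {1..T}. \<integral>\<^sup>+ w. f w * indicator (selection_event \<sigma>) w \<partial>M)"
proof -
  let ?S = "{1..n} \<rightarrow>\<^sub>E {..<E} \<times> {1..T}"
  have fin: "finite ?S" by (intro finite_PiE) auto
  have "f w = (\<Sum>\<sigma>\<in>?S. f w * indicator (selection_event \<sigma>) w)" if w: "w \<in> space M" for w
  proof -
    let ?\<sigma> = "\<lambda>i\<in>{1..n}. sel i w"
    have mem: "?\<sigma> \<in> ?S" using sel_in[OF _ w] by (auto simp: restrict_PiE_iff)
    have "w \<in> selection_event \<sigma> \<longleftrightarrow> \<sigma> = ?\<sigma>" if "\<sigma> \<in> ?S" for \<sigma>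
      using that w by (auto simp: selection_event_def PiE_iff extensional_def fun_eq_iff)
    then have "(\<Sum>\<sigma>\<in>?S. f w * indicator (selection_event \<sigma>) w) = (\<Sum>\<sigma>\<in>?S. if \<sigma> = ?\<sigma> then f w else 0)"
      by (intro sum.cong refl) (auto simp: indicator_def)
    also have "\<dots> = f w"
      using fin mem by (simp only: sum.delta if_True)
    finally show ?thesis by simp
  qed
  then have "(\<integral>\<^sup>+ w. f w \<partial>M) = (\<integral>\<^sup>+ w. (\<Sum>\<sigma>\<in>?S. f w * indicator (selection_event \<sigma>) w) \<partial>M)"
    by (intro nn_integral_cong) simp
  also have "\<dots> = (\<Sum>\<sigma>\<in>?S. \<integral>\<^sup>+ w. f w * indicator (selection_event \<sigma>) w \<partial>M)"
  proof (rule nn_integral_sum)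
    fix \<sigma> assume "\<sigma> \<in> ?S"
    then have "selection_event \<sigma> \<in> sets M"
      by (rule selection_event_indep(1)[OF _ borel_measurable_const])
    then show "(\<lambda>w. f w * indicator (selection_event \<sigma>) w) \<in> borel_measurable M"
      using f by measurable
  qed
  finally show ?thesis .
qed

text \<open>A repetition in \<open>\<sigma>\<close> would contradict almost sure distinctness on an
  event of positive probability. Square integrability is assumed for the randomly selected scores;
  by independence the second moment of the fixed score times the probability of the event is at most
  that of \<open>G i\<close>, and the positive probability is divided out.\<close>

lemma selection_event_not_null:
  assumes \<sigma>: "\<sigma> \<in> {1..n} \<rightarrow>\<^sub>E {..<E} \<times> {1..T}" and pos: "emeasure M (selection_event \<sigma>) \<noteq> 0"
  shows "inj_on \<sigma> {1..n}"
    and "\<And>i. i \<in> {1..n} \<Longrightarrow> integrable M (\<lambda>w. (norm (step_score (\<sigma> i) w))\<^sup>2)"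
proof -
  note C [measurable] = selection_event_indep(1)[OF \<sigma> borel_measurable_const]
  show "inj_on \<sigma> {1..n}"
  proof (rule inj_onI, rule ccontr)
    fix i j assume ij: "i \<in> {1..n}" "j \<in> {1..n}" "\<sigma> i = \<sigma> j" "i \<noteq> j"
    then have "AE w in M. sel i w \<noteq> sel j w"
      using selection unfolding transition_selection_def by blast
    then have "AE w in M. w \<notin> selection_event \<sigma>"
    proof eventually_elim
      case (elim w)
      show ?case
      proof
        assume "w \<in> selection_event \<sigma>"
        then have "sel i w = \<sigma> i" "sel j w = \<sigma> j"
          using ij by (simp_all add: selection_event_def)
        with elim ij show False by simp
      qed
    qed
    then have "selection_event \<sigma> \<in> null_sets M"
      using C by (simp add: AE_iff_null_sets)
    with pos show False by auto
  qed
  fix i assume i: "i \<in> {1..n}"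
  have \<sigma>i: "\<sigma> i \<in> {..<E} \<times> {1..T}" by (rule PiE_mem[OF \<sigma> i])
  have meas: "step_score (\<sigma> i) \<in> borel_measurable trajectories_algebra"
    by (rule step_measurable_trajectories(2)[OF \<sigma>i])
  have measM: "step_score (\<sigma> i) \<in> borel_measurable M"
    by (rule measurable_from_subalg[OF subalgebra_trajectories meas])
  have "emeasure M (selection_event \<sigma>) * (\<integral>\<^sup>+ w. ennreal ((norm (step_score (\<sigma> i) w))\<^sup>2) \<partial>M) =
      (\<integral>\<^sup>+ w. ennreal ((norm (step_score (\<sigma> i) w))\<^sup>2) * indicator (selection_event \<sigma>) w \<partial>M)"
    by (rule selection_event_indep(2)[OF \<sigma>, symmetric]) (use meas in measurable)
  also have "\<dots> \<le> (\<integral>\<^sup>+ w. ennreal ((norm (G i w))\<^sup>2) \<partial>M)"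
    by (rule nn_integral_mono) (use i in \<open>auto simp: G_eq selection_event_def split: split_indicator\<close>)
  also have "\<dots> < \<infinity>"
    using selected_score_square_integrable[OF i] integrable_norm_square_iff[OF G_measurable[OF i]] by simp
  finally have "(\<integral>\<^sup>+ w. ennreal ((norm (step_score (\<sigma> i) w))\<^sup>2) \<partial>M) < \<infinity>"
    using pos by (auto simp: ennreal_mult_less_top)
  then show "integrable M (\<lambda>w. (norm (step_score (\<sigma> i) w))\<^sup>2)"
    using integrable_norm_square_iff[OF measM] by simp
qed

text \<open>On each selection event the random terms coincide with those of a deterministic choice,
  which are functions of the trajectories. The probability of the event factors out, deterministic
  orthogonality applies, and the finitely many events are summed.\<close>

lemma nn_integral_selected_orthogonal:
  assumes c: "\<And>i. i \<in> {1..n} \<Longrightarrow> c i \<in> borel_measurable (X i)"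
  shows "(\<integral>\<^sup>+ w. ennreal ((norm (\<Sum>i=1..n. c i (\<xi> i w) *\<^sub>R G i w))\<^sup>2) \<partial>M) =
    (\<Sum>i=1..n. \<integral>\<^sup>+ w. ennreal ((norm (c i (\<xi> i w) *\<^sub>R G i w))\<^sup>2) \<partial>M)"
proof -
  let ?S = "{1..n} \<rightarrow>\<^sub>E {..<E} \<times> {1..T}"
  have cG: "(\<lambda>w. c i (\<xi> i w) *\<^sub>R G i w) \<in> borel_measurable M" if "i \<in> {1..n}" for i
    by (intro borel_measurable_scaleR measurable_compose[OF \<xi>_measurable c] G_measurable that)
  have split_\<sigma>: "(\<integral>\<^sup>+ w. ennreal ((norm (\<Sum>i=1..n. c i (\<xi> i w) *\<^sub>R G i w))\<^sup>2) * indicator (selection_event \<sigma>) w \<partial>M) =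
      (\<Sum>i=1..n. \<integral>\<^sup>+ w. ennreal ((norm (c i (\<xi> i w) *\<^sub>R G i w))\<^sup>2) * indicator (selection_event \<sigma>) w \<partial>M)"
    if \<sigma>: "\<sigma> \<in> ?S" for \<sigma>
  proof (cases "emeasure M (selection_event \<sigma>) = 0")
    case True
    then have "selection_event \<sigma> \<in> null_sets M"
      using selection_event_indep(1)[OF \<sigma> borel_measurable_const] by auto
    then show ?thesis
      by (simp add: nn_integral_null_set)
  next
    case False
    have \<sigma>i: "\<sigma> i \<in> {..<E} \<times> {1..T}" if "i \<in> {1..n}" for i
      by (rule PiE_mem[OF \<sigma> that])
    define d where "d i h = c i (x i (snd (\<sigma> i)) h)" for i h
    define Z where "Z i w = d i (step_history (\<sigma> i) w) *\<^sub>R step_score (\<sigma> i) w" for i w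
    have d: "d i \<in> borel_measurable (history_space S A (snd (\<sigma> i)))" if "i \<in> {1..n}" for i
      unfolding d_def[abs_def] using \<sigma>i[OF that]
      by (intro measurable_compose[OF x_measurable c] that) auto
    have Z: "Z i \<in> borel_measurable trajectories_algebra" if "i \<in> {1..n}" for i
      unfolding Z_def[abs_def]
      by (intro borel_measurable_scaleR measurable_compose[OF step_measurable_trajectories(1) d]
          step_measurable_trajectories(2) \<sigma>i that)
    have sumZ: "(\<lambda>w. \<Sum>i=1..n. Z i w) \<in> borel_measurable trajectories_algebra"
      by (rule borel_measurable_sum) (rule Z)
    have eq: "c i (\<xi> i w) *\<^sub>R G i w = Z i w" if "i \<in> {1..n}" "w \<in> selection_event \<sigma>" for i w
      using that by (auto simp: Z_def d_def \<xi>_eq G_eq selection_event_def)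
    have "(\<integral>\<^sup>+ w. ennreal ((norm (\<Sum>i=1..n. c i (\<xi> i w) *\<^sub>R G i w))\<^sup>2) * indicator (selection_event \<sigma>) w \<partial>M) =
        (\<integral>\<^sup>+ w. ennreal ((norm (\<Sum>i=1..n. Z i w))\<^sup>2) * indicator (selection_event \<sigma>) w \<partial>M)"
      by (rule nn_integral_cong) (simp add: eq split: split_indicator)
    also have "\<dots> = emeasure M (selection_event \<sigma>) * (\<integral>\<^sup>+ w. ennreal ((norm (\<Sum>i=1..n. Z i w))\<^sup>2) \<partial>M)"
      by (rule selection_event_indep(2)[OF \<sigma>]) (use sumZ in measurable)
    also have "(\<integral>\<^sup>+ w. ennreal ((norm (\<Sum>i=1..n. Z i w))\<^sup>2) \<partial>M) =
        (\<Sum>i=1..n. \<integral>\<^sup>+ w. ennreal ((norm (Z i w))\<^sup>2) \<partial>M)"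
      unfolding Z_def
      by (rule nn_integral_step_scores_orthogonal[OF finite_atLeastAtMost image_subsetI[OF \<sigma>i]
            selection_event_not_null[OF \<sigma> False] d])
    also have "emeasure M (selection_event \<sigma>) * \<dots> =
        (\<Sum>i=1..n. emeasure M (selection_event \<sigma>) * (\<integral>\<^sup>+ w. ennreal ((norm (Z i w))\<^sup>2) \<partial>M))"
      by (rule sum_distrib_left)
    also have "\<dots> = (\<Sum>i=1..n. \<integral>\<^sup>+ w. ennreal ((norm (c i (\<xi> i w) *\<^sub>R G i w))\<^sup>2) * indicator (selection_event \<sigma>) w \<partial>M)"
    proof (rule sum.cong[OF refl])
      fix i assume i: "i \<in> {1..n}"
      have "(\<lambda>w. ennreal ((norm (Z i w))\<^sup>2)) \<in> borel_measurable trajectories_algebra"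
        using Z[OF i] by measurable
      from selection_event_indep(2)[OF \<sigma> this, symmetric]
      show "emeasure M (selection_event \<sigma>) * (\<integral>\<^sup>+ w. ennreal ((norm (Z i w))\<^sup>2) \<partial>M) =
          (\<integral>\<^sup>+ w. ennreal ((norm (c i (\<xi> i w) *\<^sub>R G i w))\<^sup>2) * indicator (selection_event \<sigma>) w \<partial>M)"
        by (rule trans) (rule nn_integral_cong, simp del: norm_scaleR add: eq[OF i] split: split_indicator)
    qed
    finally show ?thesis .
  qed
  have sumG: "(\<lambda>w. \<Sum>i=1..n. c i (\<xi> i w) *\<^sub>R G i w) \<in> borel_measurable M"
    by (rule borel_measurable_sum) (rule cG)
  have "(\<integral>\<^sup>+ w. ennreal ((norm (\<Sum>i=1..n. c i (\<xi> i w) *\<^sub>R G i w))\<^sup>2) \<partial>M) =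
      (\<Sum>\<sigma>\<in>?S. \<integral>\<^sup>+ w. ennreal ((norm (\<Sum>i=1..n. c i (\<xi> i w) *\<^sub>R G i w))\<^sup>2) *
        indicator (selection_event \<sigma>) w \<partial>M)"
    by (rule nn_integral_split_selection) (use sumG in measurable)
  also have "\<dots> = (\<Sum>\<sigma>\<in>?S. \<Sum>i=1..n. \<integral>\<^sup>+ w. ennreal ((norm (c i (\<xi> i w) *\<^sub>R G i w))\<^sup>2) *
      indicator (selection_event \<sigma>) w \<partial>M)"
    by (rule sum.cong[OF refl split_\<sigma>])
  also have "\<dots> = (\<Sum>i=1..n. \<Sum>\<sigma>\<in>?S. \<integral>\<^sup>+ w. ennreal ((norm (c i (\<xi> i w) *\<^sub>R G i w))\<^sup>2) * indicator (selection_event \<sigma>) w \<partial>M)"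
    by (rule sum.swap)
  also have "\<dots> = (\<Sum>i=1..n. \<integral>\<^sup>+ w. ennreal ((norm (c i (\<xi> i w) *\<^sub>R G i w))\<^sup>2) \<partial>M)"
    by (intro sum.cong refl nn_integral_split_selection[symmetric]) (use cG in measurable)
  finally show ?thesis .
qed

lemma \<xi>_in_space: "i \<in> {1..n} \<Longrightarrow> \<xi> i \<in> space M \<rightarrow> space (X i)"
  using measurable_space[OF \<xi>_measurable] by auto

lemma subalgebra_\<xi>: "i \<in> {1..n} \<Longrightarrow> subalgebra M (vimage_algebra (space M) (\<xi> i) (X i))"
  unfolding subalgebra_def by (simp add: sets_image_in_sets[OF refl \<xi>_measurable])

lemma measurable_vimage_\<xi>:
  "i \<in> {1..n} \<Longrightarrow> c \<in> borel_measurable (X i) \<Longrightarrow>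
    (\<lambda>w. c (\<xi> i w)) \<in> borel_measurable (vimage_algebra (space M) (\<xi> i) (X i))"
  by (rule measurable_compose[OF measurable_vimage_algebra1[OF \<xi>_in_space]])

text \<open>Orthogonality is known for functions of the inputs, but the locale asks for all weights
  measurable with respect to the algebra they generate, such as quotients of conditional
  expectations. Such weights factor through the inputs.\<close>

sublocale orthogonal_weights M "{1..n}" "\<lambda>i. vimage_algebra (space M) (\<xi> i) (X i)" G
proof unfold_locales
  fix v :: "nat \<Rightarrow> 'w \<Rightarrow> real"
  assume v: "\<And>i. i \<in> {1..n} \<Longrightarrow> v i \<in> borel_measurable (vimage_algebra (space M) (\<xi> i) (X i))"
  have "\<exists>c. c \<in> borel_measurable (X i) \<and> (\<forall>w\<in>space M. v i w = c (\<xi> i w))" if "i \<in> {1..n}" for i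
    using borel_measurable_vimage_algebra_factor[OF \<xi>_in_space[OF that] v[OF that]] by metis
  then obtain c where c: "\<And>i. i \<in> {1..n} \<Longrightarrow> c i \<in> borel_measurable (X i)"
    and v_eq: "\<And>i w. i \<in> {1..n} \<Longrightarrow> w \<in> space M \<Longrightarrow> v i w = c i (\<xi> i w)"
    by metis
  have "(\<integral>\<^sup>+ w. ennreal ((norm (\<Sum>i=1..n. v i w *\<^sub>R G i w))\<^sup>2) \<partial>M) =
      (\<integral>\<^sup>+ w. ennreal ((norm (\<Sum>i=1..n. c i (\<xi> i w) *\<^sub>R G i w))\<^sup>2) \<partial>M)"
    by (rule nn_integral_cong) (simp add: v_eq)
  also have "\<dots> = (\<Sum>i=1..n. \<integral>\<^sup>+ w. ennreal ((norm (c i (\<xi> i w) *\<^sub>R G i w))\<^sup>2) \<partial>M)"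
    by (rule nn_integral_selected_orthogonal[OF c])
  also have "\<dots> = (\<Sum>i=1..n. \<integral>\<^sup>+ w. ennreal ((norm (v i w *\<^sub>R G i w))\<^sup>2) \<partial>M)"
    by (intro sum.cong refl nn_integral_cong) (simp add: v_eq)
  finally show "(\<integral>\<^sup>+ w. ennreal ((norm (\<Sum>i\<in>{1..n}. v i w *\<^sub>R G i w))\<^sup>2) \<partial>M) =
      (\<Sum>i\<in>{1..n}. \<integral>\<^sup>+ w. ennreal ((norm (v i w *\<^sub>R G i w))\<^sup>2) \<partial>M)" .
qed (use subalgebra_\<xi> G_measurable selected_score_square_integrable in auto)

section \<open>Minimizers for given return estimates\<close>

context
  fixes F :: "nat \<Rightarrow> 'w \<Rightarrow> real"
  assumes F_measurable: "\<And>i. i \<in> {1..n} \<Longrightarrow> F i \<in> borel_measurable M"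
    and g_sf_square_integrable: "integrable M (\<lambda>w. (norm (g_sf n F G w))\<^sup>2)"
begin

definition quotient :: "nat \<Rightarrow> 'w \<Rightarrow> real" where
  "quotient i w = cond_exp_given M (X i) (\<xi> i) (\<lambda>w. g_sf n F G w \<bullet> G i w) w /
    cond_exp_given M (X i) (\<xi> i) (\<lambda>w. G i w \<bullet> G i w) w"

text \<open>The gap between the second moment of the estimator with baseline \<open>\<beta>\<close>
  and that of the projection residual.\<close>

definition excess :: "(nat \<Rightarrow> 'x \<Rightarrow> real) \<Rightarrow> ennreal" where
  "excess \<beta> = (\<Sum>i=1..n. second_moment M (\<lambda>w. (\<beta> i (\<xi> i w) - quotient i w) *\<^sub>R G i w))"

lemma g_sf_measurable: "g_sf n F G \<in> borel_measurable M"
  unfolding g_sf_def[abs_def]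
  by (intro borel_measurable_sum borel_measurable_scaleR F_measurable G_measurable)

lemma g_hat_eq: "g_hat n F \<xi> G \<beta> = (\<lambda>w. g_sf n F G w - (\<Sum>i=1..n. \<beta> i (\<xi> i w) *\<^sub>R G i w))"
  by (simp add: g_hat_def g_sf_def fun_eq_iff scaleR_diff_left sum_subtractf)

lemma second_moment_g_hat:
  assumes "\<beta> \<in> baselines X n"
  shows "second_moment M (g_hat n F \<xi> G \<beta>) =
      second_moment M (\<lambda>w. g_sf n F G w - (\<Sum>i=1..n. quotient i w *\<^sub>R G i w)) + excess \<beta>"
    and "second_moment M (\<lambda>w. g_sf n F G w - (\<Sum>i=1..n. quotient i w *\<^sub>R G i w)) < \<infinity>"
proof -
  have \<beta>: "(\<lambda>w. \<beta> i (\<xi> i w)) \<in> borel_measurable (vimage_algebra (space M) (\<xi> i) (X i))"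
    if "i \<in> {1..n}" for i
    using assms that by (intro measurable_vimage_\<xi>) (auto simp: baselines_def)
  note pythagoras = second_moment_pythagoras[OF g_sf_measurable g_sf_square_integrable \<beta>, of quotient]
  have q: "quotient i = (\<lambda>w. real_cond_exp M (vimage_algebra (space M) (\<xi> i) (X i)) (\<lambda>w. g_sf n F G w \<bullet> G i w) w /
      real_cond_exp M (vimage_algebra (space M) (\<xi> i) (X i)) (\<lambda>w. G i w \<bullet> G i w) w)" for i
    by (simp add: quotient_def[abs_def] cond_exp_given_def)
  show "second_moment M (g_hat n F \<xi> G \<beta>) =
      second_moment M (\<lambda>w. g_sf n F G w - (\<Sum>i=1..n. quotient i w *\<^sub>R G i w)) + excess \<beta>"
    unfolding g_hat_eq excess_def by (rule pythagoras(1)) (simp_all add: q)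
  show "second_moment M (\<lambda>w. g_sf n F G w - (\<Sum>i=1..n. quotient i w *\<^sub>R G i w)) < \<infinity>"
    by (rule pythagoras(2)) (simp_all add: q)
qed

lemma quotient_measurable_\<xi>:
  "quotient i \<in> borel_measurable (vimage_algebra (space M) (\<xi> i) (X i))"
  unfolding quotient_def[abs_def] cond_exp_given_def by measurable

lemma excess_eq_0_iff:
  assumes "\<beta> \<in> baselines X n"
  shows "excess \<beta> = 0 \<longleftrightarrow> given_by_quotient M X n F \<xi> G \<beta>"
proof -
  have "second_moment M (\<lambda>w. (\<beta> i (\<xi> i w) - quotient i w) *\<^sub>R G i w) = 0 \<longleftrightarrow>
      (AE w in M. cond_exp_given M (X i) (\<xi> i) (\<lambda>w. G i w \<bullet> G i w) w \<noteq> 0 \<longrightarrow> \<beta> i (\<xi> i w) = quotient i w)"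
    if i: "i \<in> {1..n}" for i
  proof -
    interpret N: finite_measure_subalgebra M "vimage_algebra (space M) (\<xi> i) (X i)"
      using subalgebra_\<xi>[OF i] by unfold_locales
    have "(\<lambda>w. \<beta> i (\<xi> i w) - quotient i w) \<in> borel_measurable (vimage_algebra (space M) (\<xi> i) (X i))"
      using assms i by (intro borel_measurable_diff measurable_vimage_\<xi> quotient_measurable_\<xi>)
        (auto simp: baselines_def)
    from N.nn_integral_norm_square_scaleR_eq_0_iff[OF G_measurable[OF i] _ this]
    show ?thesis
      using selected_score_square_integrable[OF i]
      by (simp add: second_moment_def cond_exp_given_def power2_norm_eq_inner)
  qed
  then show ?thesis
    unfolding excess_def given_by_quotient_def by (simp add: quotient_def)
qed

text \<open>The quotient is a function on the sample space that is measurable with respect to the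
  algebra of the input, so the factorization makes a baseline of it.\<close>

lemma given_by_quotient_exists: "\<exists>\<beta>\<in>baselines X n. given_by_quotient M X n F \<xi> G \<beta>"
proof -
  have "\<exists>c. c \<in> borel_measurable (X i) \<and> (\<forall>w\<in>space M. quotient i w = c (\<xi> i w))" if "i \<in> {1..n}" for i
    using borel_measurable_vimage_algebra_factor[OF \<xi>_in_space[OF that] quotient_measurable_\<xi>] by metis
  then obtain \<beta> where \<beta>: "\<And>i. i \<in> {1..n} \<Longrightarrow> \<beta> i \<in> borel_measurable (X i)"
    and eq: "\<And>i w. i \<in> {1..n} \<Longrightarrow> w \<in> space M \<Longrightarrow> quotient i w = \<beta> i (\<xi> i w)"
    by metis
  have "given_by_quotient M X n F \<xi> G \<beta>"
    unfolding given_by_quotient_def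
    by (intro ballI AE_I2 impI) (simp add: eq[symmetric] quotient_def)
  with \<beta> show ?thesis
    unfolding baselines_def by blast
qed

text \<open>Baselines are indexed by \<open>y\<close> so that the full class and a parametric class
  are treated at once. The element \<open>y0\<close> guarantees that the class reaches excess 0; a
  class that misses the quotient may have minimizers with positive excess.\<close>

lemma is_arg_min_second_moment_iff:
  assumes base: "\<And>y. P y \<Longrightarrow> \<beta> y \<in> baselines X n"
    and y0: "P y0" "given_by_quotient M X n F \<xi> G (\<beta> y0)" and y: "P y"
  shows "is_arg_min (\<lambda>y. second_moment M (g_hat n F \<xi> G (\<beta> y))) P y \<longleftrightarrow>
    given_by_quotient M X n F \<xi> G (\<beta> y)"
proof -
  have "is_arg_min (\<lambda>y. second_moment M (g_hat n F \<xi> G (\<beta> y))) P y \<longleftrightarrow> excess (\<beta> y) = 0"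
    using y0(2) excess_eq_0_iff[OF base[OF y0(1)]]
    by (intro is_arg_min_add_const_iff[where P = P and R = "\<lambda>y. excess (\<beta> y)",
          OF second_moment_g_hat(1)[OF base] second_moment_g_hat(2)[OF base[OF y]] y0(1) _ y]) simp_all
  then show ?thesis
    using excess_eq_0_iff[OF base[OF y]] by simp
qed

end

end

theorem theorem1:
  fixes M :: "'w measure" and S :: "'s measure" and A :: "'a measure"
    and \<pi> :: "'p::euclidean_space \<Rightarrow> 's \<Rightarrow> 'a \<Rightarrow> real" and \<theta> :: 'p
    and K :: "'s \<times> 'a \<Rightarrow> (real \<times> 's) measure"
    and T E n :: nat
    and s :: "nat \<Rightarrow> nat \<Rightarrow> 'w \<Rightarrow> 's" and a :: "nat \<Rightarrow> nat \<Rightarrow> 'w \<Rightarrow> 'a"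
    and r :: "nat \<Rightarrow> nat \<Rightarrow> 'w \<Rightarrow> real"
    and sel :: "nat \<Rightarrow> 'w \<Rightarrow> nat \<times> nat"
    and F :: "nat \<Rightarrow> 'w \<Rightarrow> real"
    and X :: "nat \<Rightarrow> 'x measure"
    and x :: "nat \<Rightarrow> nat \<Rightarrow> (nat \<Rightarrow> 's) \<times> (nat \<Rightarrow> 'a) \<times> (nat \<Rightarrow> real) \<Rightarrow> 'x"
    and G :: "nat \<Rightarrow> 'w \<Rightarrow> 'p" and \<xi> :: "nat \<Rightarrow> 'w \<Rightarrow> 'x"
    and \<Phi> :: "'f set" and b :: "'f \<Rightarrow> 'x \<Rightarrow> real"
  assumes "prob_space M" and "sigma_finite_measure A"
    and "policy_family S A \<pi>" and "regular_policy S A \<pi> \<theta>"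
    and "K \<in> S \<Otimes>\<^sub>M A \<rightarrow>\<^sub>M prob_algebra (borel \<Otimes>\<^sub>M S)"
    and "independent_episodes M S A (\<pi> \<theta>) K T E s a r"
    and "transition_selection M S A T E s a r n sel"
    and "\<And>i. i \<in> {1..n} \<Longrightarrow> F i \<in> borel_measurable M"
    and "\<And>i t. i \<in> {1..n} \<Longrightarrow> t \<in> {1..T} \<Longrightarrow> x i t \<in> history_space S A t \<rightarrow>\<^sub>M X i"
    and "G = selected_score \<pi> \<theta> s a sel"
    and "\<xi> = selected_input x s a r sel"
    and "\<And>i. i \<in> {1..n} \<Longrightarrow> integrable M (\<lambda>w. (norm (G i w))\<^sup>2)"
    and "integrable M (\<lambda>w. (norm (g_sf n F G w))\<^sup>2)"
    and "\<And>\<phi>. \<phi> \<in> \<Phi> \<Longrightarrow> (\<lambda>i. b \<phi>) \<in> baselines X n"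
  shows "(\<exists>\<beta>\<in>baselines X n. given_by_quotient M X n F \<xi> G \<beta>) \<and>
    (\<forall>\<beta>\<in>baselines X n.
       is_arg_min (\<lambda>\<beta>'. second_moment M (g_hat n F \<xi> G \<beta>')) (\<lambda>\<beta>'. \<beta>' \<in> baselines X n) \<beta> \<longleftrightarrow>
       given_by_quotient M X n F \<xi> G \<beta>) \<and>
    ((\<exists>\<phi>\<in>\<Phi>. given_by_quotient M X n F \<xi> G (\<lambda>i. b \<phi>)) \<longrightarrow>
      (\<forall>\<phi>\<in>\<Phi>.
         is_arg_min (\<lambda>\<phi>'. second_moment M (g_hat n F \<xi> G (\<lambda>i. b \<phi>'))) (\<lambda>\<phi>'. \<phi>' \<in> \<Phi>) \<phi> \<longleftrightarrow>
         given_by_quotient M X n F \<xi> G (\<lambda>i. b \<phi>)))"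
proof -
  interpret prob_space M by fact
  interpret actions: sigma_finite_measure A by fact
  interpret selected_transitions M A S \<pi> \<theta> K T E s a r n sel X x
    by unfold_locales (use assms in auto)
  note F = assms(8) and g2 = assms(13)[unfolded assms(10)]
  note arg_min = is_arg_min_second_moment_iff[OF F g2]
  \<comment> \<open>In the class of all measurable baselines the reference element exists by
    factorization; in the parametric class it comes from the premise that some parameter attains the
    quotient.\<close>
  obtain \<beta>0 where \<beta>0: "\<beta>0 \<in> baselines X n" "given_by_quotient M X n F \<xi> G \<beta>0"
    using given_by_quotient_exists[OF F g2] unfolding assms(10,11) by blast
  show ?thesis
    unfolding assms(10,11)
  proof (intro conjI ballI impI)
    show "\<exists>\<beta>\<in>baselines X n. given_by_quotient M X n F
        (selected_input x s a r sel) (selected_score \<pi> \<theta> s a sel) \<beta>"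
      by (rule given_by_quotient_exists[OF F g2])
  next
    fix \<beta> assume "\<beta> \<in> baselines X n"
    with \<beta>0 show "is_arg_min (\<lambda>\<beta>'. second_moment M (g_hat n F (selected_input x s a r sel)
          (selected_score \<pi> \<theta> s a sel) \<beta>')) (\<lambda>\<beta>'. \<beta>' \<in> baselines X n) \<beta> \<longleftrightarrow>
        given_by_quotient M X n F (selected_input x s a r sel) (selected_score \<pi> \<theta> s a sel) \<beta>"
      unfolding assms(10,11) by (intro arg_min[where \<beta> = "\<lambda>\<beta>. \<beta>"])
  next
    fix \<phi> assume "\<exists>\<phi>\<in>\<Phi>. given_by_quotient M X n F (selected_input x s a r sel)
      (selected_score \<pi> \<theta> s a sel) (\<lambda>i. b \<phi>)" and \<phi>: "\<phi> \<in> \<Phi>"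
    then obtain \<phi>0 where \<phi>0: "\<phi>0 \<in> \<Phi>" "given_by_quotient M X n F (selected_input x s a r sel)
      (selected_score \<pi> \<theta> s a sel) (\<lambda>i. b \<phi>0)" by blast
    show "is_arg_min (\<lambda>\<phi>'. second_moment M (g_hat n F (selected_input x s a r sel)
          (selected_score \<pi> \<theta> s a sel) (\<lambda>i. b \<phi>'))) (\<lambda>\<phi>'. \<phi>' \<in> \<Phi>) \<phi> \<longleftrightarrow>
        given_by_quotient M X n F (selected_input x s a r sel) (selected_score \<pi> \<theta> s a sel) (\<lambda>i. b \<phi>)"
      by (rule arg_min[where \<beta> = "\<lambda>\<phi> i. b \<phi>", OF _ _ \<phi>0 \<phi>]) (assumption | rule assms(14))+
  qed
qed

end
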